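(* For integers $n\ge 1$ let $\mathcal{P}_n$ be the set of trigonometric polynomials of the form $p(t)=\sum_{k=1}^n c_k e^{2\pi i m_k t}$ with $c_k\in\mathbb{C}$, $m_k\in\mathbb{Z}$ and $m_1<\cdots<m_n$. Let $C^{\alpha}_{\mathcal{H}}$ denote the $\alpha$-Hausdorff content. (i) For every $\alpha\in(0,1)$, the following assertion is false: for every $E\subset[0,1]$ with $C^{\alpha}_{\mathcal{H}}(E)>0$ and every $n\ge1$ there is a constant $C$, depending only on $E$ and $n$, such that $$\sup_{t\in[0,1]}|p(t)|\le C\sup_{t\in E}|p(t)|\qquad\text{for all } p\in\mathcal{P}_n .$$ (ii) There exists an absolute constant $C_0>0$ such that for every $\alpha\in(0,1)$, every $E\subset[0,1]$ with $C^{\alpha}_{\mathcal{H}}(E)>0$, every $n\ge 1$ and every $p(t)=\sum_{k=1}^n c_k e^{2\pi i m_k t}\in\mathcal{P}_n$, $$\sup_{t\in[0,1]}|p(t)|\le\left(\Big(\frac{C_0(n-1)}{C^{\alpha}_{\mathcal{H}}(E)}\Big)^{1/\alpha}(m_n-m_1)^{1/\alpha-1}\right)^{n-1}\sup_{t\in E}|p(t)| .$$ Moreover, this is sharp in the following sense: for every $\alpha\in(0,1)$ and every $\varepsilon>0$, the following assertion is false: for every $E\subset[0,1]$ with $C^{\alpha}_{\mathcal{H}}(E)>0$ and every $n\ge1$ there is a constant $C_1$, depending only on $E$ and $n$, such that $$\sup_{t\in[0,1]}|p(t)|\le C_1\left((m_n-m_1)^{1/\alpha-1-\varepsilon}\right)^{n-1}\sup_{t\in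 E}|p(t)|\qquad\text{for all } p(t)=\sum_{k=1}^n c_k e^{2\pi i m_k t}\in\mathcal{P}_n .$$
   Context: For $\alpha>0$, the $\alpha$-Hausdorff content of a set $E\subset\mathbb{R}$ is $$C^{\alpha}_{\mathcal{H}}(E)=\inf\Big\{\sum_j r_j^{\alpha}: E\subset\bigcup_j B(x_j,r_j)\Big\},$$ where the infimum is over countable covers of $E$ by balls $B(x_j,r_j)$ (center $x_j$, radius $r_j$). When $n=1$ the factors of the form $(\cdots)^{n-1}$ are understood as $1$. *)

theory Defs
  imports "HOL-Analysis.Analysis"
begin

text \<open>
  Covers are sequences of open balls. A ball of radius \<open>0\<close> is empty and contributes
  \<open>0 powr \<alpha> = 0\<close>, so finite covers (and, for the empty set, the empty cover) are included.
\<close>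

definition hausdorff_content :: "real \<Rightarrow> real set \<Rightarrow> ennreal" where
  "hausdorff_content \<alpha> E =
     Inf {(\<Sum>j. ennreal (r j powr \<alpha>)) | (x :: nat \<Rightarrow> real) (r :: nat \<Rightarrow> real).
            (\<forall>j. 0 \<le> r j) \<and> E \<subseteq> (\<Union>j. ball (x j) (r j))}"

text \<open>In particular \<^const>\<open>enn2real\<close> loses nothing on the contents of subsets of the unit interval.\<close>

lemma hausdorff_content_unit_interval_le_1:
  assumes "E \<subseteq> {0..1}"
  shows "hausdorff_content \<alpha> E \<le> 1"
proof -
  define r :: "nat \<Rightarrow> real" where "r = (\<lambda>j. if j = 0 then 1 else 0)"
  have "(\<Sum>j. ennreal (r j powr \<alpha>)) = (\<Sum>j\<in>{0}. ennreal (r j powr \<alpha>))"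
    by (rule suminf_finite) (auto simp: r_def)
  then have "(\<Sum>j. ennreal (r j powr \<alpha>)) = 1"
    by (simp add: r_def)
  moreover have "E \<subseteq> (\<Union>j. ball (1/2) (r j))"
  proof
    fix t assume "t \<in> E"
    with assms have "0 \<le> t" "t \<le> 1" by auto
    then have "t \<in> ball (1/2) (r 0)"
      by (simp add: r_def dist_real_def)
    then show "t \<in> (\<Union>j. ball (1/2) (r j))" by blast
  qed
  moreover have "\<forall>j. 0 \<le> r j" by (simp add: r_def)
  ultimately show ?thesis
    unfolding hausdorff_content_def
    by (intro Inf_lower CollectI exI[of _ "\<lambda>_. 1/2"] exI[of _ r]) simp
qed

definition trig_poly :: "nat \<Rightarrow> (nat \<Rightarrow> complex) \<Rightarrow> (nat \<Rightarrow> int) \<Rightarrow> real \<Rightarrow> complex" where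
  "trig_poly n c m t =
     (\<Sum>k = 1..n. c k * exp (2 * of_real pi * \<i> * of_int (m k) * of_real t))"

text \<open>The coefficients are arbitrary complex numbers; they may vanish.\<close>

definition trig_polys :: "nat \<Rightarrow> (real \<Rightarrow> complex) set" where
  "trig_polys n = {trig_poly n c m | c m. strict_mono_on {1..n} m}"

end

theory Submission
  imports Defs "HOL-Complex_Analysis.Complex_Analysis"
    "HOL-Computational_Algebra.Fundamental_Theorem_Algebra"
begin

text \<open>
  Upper bound. Shift the frequencies so that the smallest or the largest one vanishes, and differentiate:
  this removes one frequency, and for one of the two choices the sum of the moduli of the coefficients
  grows at least by the factor \<open>(m\<^sub>n - m\<^sub>1) / 2\<close>. On the other hand, by a Kolmogorov type estimate the logarithmic
  derivative of a polynomial of degree \<open>N\<close> exceeds \<open>y\<close> on a subset of the unit circle of measure at most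
  \<open>4 N / y\<close>. This set consists of at most \<open>2 N + 1\<close> arcs, hence its content is at most
  \<open>4 N / y powr \<alpha>\<close>, and discarding it from \<open>E\<close> costs only a small part of the content. After \<open>n - 1\<close> steps
  a single frequency is left.

  Sharpness. Let \<open>E\<close> consist of the numbers whose binary digits vanish outside a set of positions with
  lower density \<open>\<alpha>\<close> and with very long gaps. Removing the gaps is an \<open>\<alpha>\<close>-Hoelder map of \<open>E\<close> onto \<open>[0, 1)\<close>, so \<open>E\<close> has
  positive content, but \<open>1 - exp (2 \<pi> \<i> 2\<^sup>q t)\<close> is small on \<open>E\<close> if a gap starts after position \<open>q\<close>.
\<close>

section \<open>Hausdorff content\<close>

lemma hausdorff_content_le:
  assumes "\<And>j. 0 \<le> r j" "E \<subseteq> (\<Union>j. ball (x j) (r j))"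
  shows "hausdorff_content \<alpha> E \<le> (\<Sum>j. ennreal (r j powr \<alpha>))"
  unfolding hausdorff_content_def by (rule Inf_lower) (use assms in blast)

lemma hausdorff_content_mono:
  assumes "A \<subseteq> B"
  shows "hausdorff_content \<alpha> A \<le> hausdorff_content \<alpha> B"
  unfolding hausdorff_content_def by (rule Inf_superset_mono) (use assms in blast)

lemma hausdorff_content_empty: "hausdorff_content \<alpha> {} = 0"
proof -
  have "hausdorff_content \<alpha> {} \<le> (\<Sum>j. ennreal ((\<lambda>_. 0) j powr \<alpha>))"
    by (rule hausdorff_content_le) auto
  then show ?thesis by simp
qed

text \<open>Prepending the ball to a cover of \<open>A\<close> costs \<open>r powr \<alpha>\<close>.
  Moving this cost to the left by \<open>ennreal\<close> subtraction turns the claim into a lower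
  bound for the sums of all covers of \<open>A\<close>.\<close>

lemma hausdorff_content_Un_ball:
  assumes "0 \<le> r"
  shows "hausdorff_content \<alpha> (A \<union> ball x r) \<le> hausdorff_content \<alpha> A + ennreal (r powr \<alpha>)"
proof -
  have "hausdorff_content \<alpha> (A \<union> ball x r) \<le> y + ennreal (r powr \<alpha>)"
    if cover: "y = (\<Sum>j. ennreal (\<rho> j powr \<alpha>))" "\<forall>j. 0 \<le> \<rho> j" "A \<subseteq> (\<Union>j. ball (z j) (\<rho> j))"
    for y z \<rho>
  proof -
    define z' where "z' = (\<lambda>j. case j of 0 \<Rightarrow> x | Suc i \<Rightarrow> z i)"
    define \<rho>' where "\<rho>' = (\<lambda>j. case j of 0 \<Rightarrow> r | Suc i \<Rightarrow> \<rho> i)"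
    have "(\<Union>j. ball (z' j) (\<rho>' j)) \<supseteq> A \<union> ball x r"
    proof
      fix t assume "t \<in> A \<union> ball x r"
      then consider "t \<in> ball (z' 0) (\<rho>' 0)" | i where "t \<in> ball (z' (Suc i)) (\<rho>' (Suc i))"
        using cover(3) by (auto simp: z'_def \<rho>'_def)
      then show "t \<in> (\<Union>j. ball (z' j) (\<rho>' j))" by cases blast+
    qed
    then have "hausdorff_content \<alpha> (A \<union> ball x r) \<le> (\<Sum>j. ennreal (\<rho>' j powr \<alpha>))"
      by (intro hausdorff_content_le) (use cover assms in \<open>auto simp: \<rho>'_def split: nat.split\<close>)
    also have "(\<lambda>j. ennreal (\<rho>' j powr \<alpha>)) sums (y + ennreal (\<rho>' 0 powr \<alpha>))"
      unfolding cover(1) by (rule sums_Suc) (simp add: \<rho>'_def summable_sums)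
    then have "(\<Sum>j. ennreal (\<rho>' j powr \<alpha>)) = y + ennreal (r powr \<alpha>)"
      by (simp add: sums_iff \<rho>'_def)
    finally show ?thesis .
  qed
  then have "hausdorff_content \<alpha> (A \<union> ball x r) - ennreal (r powr \<alpha>) \<le> hausdorff_content \<alpha> A"
    unfolding hausdorff_content_def[of \<alpha> A]
    by (intro Inf_greatest) (auto simp: ennreal_minus_le_iff add.commute)
  then show ?thesis by (simp add: ennreal_minus_le_iff add.commute)
qed

lemma hausdorff_content_UN_balls:
  assumes "finite I" "\<And>i. i \<in> I \<Longrightarrow> 0 \<le> r i"
  shows "hausdorff_content \<alpha> (A \<union> (\<Union>i\<in>I. ball (x i) (r i)))
           \<le> hausdorff_content \<alpha> A + ennreal (\<Sum>i\<in>I. r i powr \<alpha>)"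
  using assms
proof (induction I rule: finite_induct)
  case (insert i I)
  let ?B = "A \<union> (\<Union>i\<in>I. ball (x i) (r i))"
  have "hausdorff_content \<alpha> (?B \<union> ball (x i) (r i)) \<le> hausdorff_content \<alpha> ?B + ennreal (r i powr \<alpha>)"
    using insert.prems by (intro hausdorff_content_Un_ball) auto
  also have "\<dots> \<le> (hausdorff_content \<alpha> A + ennreal (\<Sum>i\<in>I. r i powr \<alpha>)) + ennreal (r i powr \<alpha>)"
    using insert by (intro add_right_mono) auto
  also have "\<dots> = hausdorff_content \<alpha> A + ennreal (\<Sum>i\<in>insert i I. r i powr \<alpha>)"
    using insert.hyps by (simp add: add.assoc add.commute sum_nonneg flip: ennreal_plus)
  finally show ?case by (simp add: Un_ac)
qed simp

lemma hausdorff_content_insert: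
  assumes "\<alpha> > 0"
  shows "hausdorff_content \<alpha> (insert x A) \<le> hausdorff_content \<alpha> A"
proof (rule ennreal_le_epsilon)
  fix e :: real assume "0 < e"
  define r where "r = e powr (1/\<alpha>)"
  have "r > 0" "r powr \<alpha> = e"
    using assms \<open>0 < e\<close> by (auto simp: r_def powr_powr)
  moreover have "hausdorff_content \<alpha> (insert x A) \<le> hausdorff_content \<alpha> (A \<union> ball x r)"
    using \<open>r > 0\<close> by (intro hausdorff_content_mono) auto
  ultimately show "hausdorff_content \<alpha> (insert x A) \<le> hausdorff_content \<alpha> A + ennreal e"
    using hausdorff_content_Un_ball[of r \<alpha> A x] by simp
qed

lemma hausdorff_content_Un_finite:
  assumes "\<alpha> > 0" "finite F"
  shows "hausdorff_content \<alpha> (A \<union> F) \<le> hausdorff_content \<alpha> A"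
  using assms(2)
proof (induction F rule: finite_induct)
  case (insert x F)
  then show ?case
    using hausdorff_content_insert[OF assms(1), of x "A \<union> F"] by simp
qed simp

text \<open>Jensen's inequality for the concave power: the bound is
  \<open>K * (S/K) powr \<alpha>\<close>. The tangent at \<open>S/K\<close>, obtained from Young's
  inequality, has nonnegative slope and intercept, so the number of terms and their total may be
  replaced by the upper bounds \<open>K\<close> and \<open>S\<close>.\<close>

lemma sum_powr_le:
  fixes l :: "'a \<Rightarrow> real"
  assumes "finite A" "0 < \<alpha>" "\<alpha> < 1" "\<And>a. a \<in> A \<Longrightarrow> 0 < l a"
    and K: "real (card A) \<le> K" and S: "(\<Sum>a\<in>A. l a) \<le> S"
  shows "(\<Sum>a\<in>A. l a powr \<alpha>) \<le> K powr (1-\<alpha>) * S powr \<alpha>"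
proof (cases "A = {}")
  case False
  have "(\<Sum>a\<in>A. l a) > 0" using False assms by (intro sum_pos) auto
  then have "S > 0" using S by simp
  have "card A > 0" using False assms by (simp add: card_gt_0_iff)
  then have "K > 0" using K by simp
  define \<mu> where "\<mu> = S / K"
  have "\<mu> > 0" using \<open>S > 0\<close> \<open>K > 0\<close> by (simp add: \<mu>_def)
  have tangent: "l a powr \<alpha> \<le> \<mu> powr \<alpha> * (\<alpha> * (l a / \<mu>) + (1 - \<alpha>))" if "a \<in> A" for a
  proof -
    have "l a powr \<alpha> * \<mu> powr (1-\<alpha>) \<le> \<alpha> * l a + (1-\<alpha>) * \<mu>"
      using assms that \<open>\<mu> > 0\<close> by (intro Youngs_inequality_0) auto
    then have "l a powr \<alpha> \<le> (\<alpha> * l a + (1-\<alpha>) * \<mu>) / \<mu> powr (1-\<alpha>)"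
      using \<open>\<mu> > 0\<close> by (simp add: field_simps)
    also have "\<dots> = \<mu> powr \<alpha> * (\<alpha> * (l a / \<mu>) + (1 - \<alpha>))"
      using \<open>\<mu> > 0\<close> by (simp add: powr_diff field_simps)
    finally show ?thesis .
  qed
  have "(\<Sum>a\<in>A. l a powr \<alpha>) \<le> (\<Sum>a\<in>A. \<mu> powr \<alpha> * (\<alpha> * (l a / \<mu>) + (1 - \<alpha>)))"
    by (intro sum_mono tangent)
  also have "\<dots> = (\<Sum>a\<in>A. (\<mu> powr \<alpha> * \<alpha> / \<mu>) * l a + \<mu> powr \<alpha> * (1 - \<alpha>))"
    by (intro sum.cong) (auto simp: algebra_simps)
  also have "\<dots> = \<mu> powr \<alpha> * (\<alpha> * ((\<Sum>a\<in>A. l a) / \<mu>) + real (card A) * (1 - \<alpha>))"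
    by (simp only: sum.distrib flip: sum_distrib_left) (simp add: algebra_simps)
  also have "\<dots> \<le> \<mu> powr \<alpha> * (\<alpha> * (S / \<mu>) + K * (1 - \<alpha>))"
    using assms \<open>\<mu> > 0\<close> by (intro mult_left_mono add_mono divide_right_mono mult_right_mono) auto
  also have "\<dots> = K powr (1-\<alpha>) * S powr \<alpha>"
    using \<open>S > 0\<close> \<open>K > 0\<close> by (simp add: \<mu>_def powr_divide powr_diff field_simps)
  finally show ?thesis .
qed simp

text \<open>The set is a union of at most \<open>k + 1\<close> gaps between consecutive zeros; concavity of \<open>x powr \<alpha>\<close> then turns
  the bound on its measure into one on its content.\<close>
lemma hausdorff_content_remove_positivity_set:
  fixes D :: "real \<Rightarrow> real"
  assumes \<alpha>: "0 < \<alpha>" "\<alpha> < 1" and E: "E \<subseteq> {0..1}"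
    and cont: "continuous_on UNIV D"
    and Z: "finite {t\<in>{0<..<1}. D t = 0}" "card {t\<in>{0<..<1}. D t = 0} \<le> k"
    and meas: "emeasure lborel {t\<in>{0..1}. D t > 0} \<le> ennreal S" "S \<ge> 0"
  shows "hausdorff_content \<alpha> E
           \<le> hausdorff_content \<alpha> {t\<in>E. D t \<le> 0} + ennreal (real (k + 1) powr (1-\<alpha>) * (S/2) powr \<alpha>)"
proof -
  \<comment> \<open>The endpoints are added so that every other point of the unit interval lies
    between two consecutive elements of \<open>Z\<close>.\<close>
  define Z where "Z = {0, 1} \<union> {t\<in>{0<..<1}. D t = 0}"
  define nxt where "nxt a = Min {z\<in>Z. z > a}" for a
  define A where "A = {a\<in>Z - {1}. \<exists>t\<in>{a<..<nxt a}. D t > 0}"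
  have "finite Z" using assms by (simp add: Z_def)
  have Z01: "Z \<subseteq> {0..1}" by (auto simp: Z_def)
  have nxt: "nxt a \<in> Z" "a < nxt a" if "a \<in> Z - {1}" for a
  proof -
    have "nxt a \<in> {z\<in>Z. z > a}"
      unfolding nxt_def using that \<open>finite Z\<close> by (intro Min_in) (auto simp: Z_def)
    then show "nxt a \<in> Z" "a < nxt a" by auto
  qed
  have nxt_le: "nxt a \<le> z" if "z \<in> Z" "a < z" for a z
    unfolding nxt_def using that \<open>finite Z\<close> by (intro Min_le) auto
  \<comment> \<open>A nonpositive value in such a gap would force a zero of \<open>D\<close>
    strictly between consecutive elements of \<open>Z\<close>.\<close>
  have pos: "D t > 0" if aA: "a \<in> A" and "t \<in> {a<..<nxt a}" for a t
  proof (rule ccontr)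
    assume "\<not> D t > 0"
    have a: "a \<in> Z - {1}" using that by (auto simp: A_def)
    obtain u where u: "u \<in> {a<..<nxt a}" "D u > 0" using aA unfolding A_def by blast
    have sub: "{a<..<nxt a} \<subseteq> {0<..<1}" using nxt[OF a] a Z01 by force
    have "connected (D ` {a<..<nxt a})"
      using sub by (intro connected_continuous_image continuous_on_subset[OF cont]) auto
    then have "0 \<in> D ` {a<..<nxt a}"
      using connectedD_interval[of "D ` {a<..<nxt a}" "D t" "D u" 0] that u \<open>\<not> D t > 0\<close> by auto
    then obtain v where v: "v \<in> {a<..<nxt a}" "D v = 0" by auto
    with sub have "v \<in> Z" by (auto simp: Z_def)
    then show False using nxt_le[of v a] v by auto
  qed
  have cov: "E \<subseteq> ({t\<in>E. D t \<le> 0} \<union> (\<Union>a\<in>A. ball ((a + nxt a)/2) ((nxt a - a)/2))) \<union> Z"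
  proof
    fix t assume t: "t \<in> E"
    show "t \<in> ({t\<in>E. D t \<le> 0} \<union> (\<Union>a\<in>A. ball ((a + nxt a)/2) ((nxt a - a)/2))) \<union> Z"
    proof (cases "D t \<le> 0 \<or> t \<in> Z")
      case False
      define a where "a = Max {z\<in>Z. z < t}"
      have "0 \<le> t" "t \<le> 1" "t \<noteq> 0" "t \<noteq> 1" using t E False by (auto simp: Z_def)
      then have "a \<in> {z\<in>Z. z < t}"
        unfolding a_def using \<open>finite Z\<close> by (intro Max_in) (auto simp: Z_def)
      then have a: "a \<in> Z - {1}" "a < t" using \<open>t \<le> 1\<close> by auto
      have "t < nxt a"
      proof (rule ccontr)
        assume "\<not> t < nxt a"
        moreover have "nxt a \<noteq> t" using nxt[OF a(1)] False by auto
        ultimately have "nxt a \<le> a"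
          unfolding a_def using nxt[OF a(1)] \<open>finite Z\<close> by (intro Max_ge) (auto simp flip: a_def)
        then show False using nxt[OF a(1)] by simp
      qed
      then have "a \<in> A" using a False by (auto simp: A_def intro!: bexI[of _ t])
      moreover have "t \<in> ball ((a + nxt a)/2) ((nxt a - a)/2)"
        using a \<open>t < nxt a\<close> by (auto simp: dist_real_def abs_if field_simps)
      ultimately show ?thesis by blast
    qed (use t in auto)
  qed
  have "finite A" using \<open>finite Z\<close> by (simp add: A_def)
  have AZ: "a \<in> Z - {1}" if "a \<in> A" for a using that by (simp add: A_def)
  have "card A \<le> card (Z - {1})" using \<open>finite Z\<close> by (intro card_mono) (auto simp: A_def)
  \<comment> \<open>Gaps are counted by their left endpoints: \<open>0\<close> and at most
    \<open>k\<close> interior zeros, but not \<open>1\<close>.\<close>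
  also have "\<dots> \<le> k + 1"
  proof -
    have "Z - {1} = insert 0 {t\<in>{0<..<1}. D t = 0}" by (auto simp: Z_def)
    then show ?thesis using assms by (simp add: card_insert_if)
  qed
  finally have card: "card A \<le> k + 1" .
  have "disjoint_family_on (\<lambda>a. {a<..<nxt a}) A"
      unfolding disjoint_family_on_def
  proof (intro ballI impI)
    have "{a<..<nxt a} \<inter> {b<..<nxt b} = {}" if "a \<in> A" "b \<in> A" "a < b" for a b
      using nxt_le[of b a] AZ[OF that(2)] that by auto
    then show "{a<..<nxt a} \<inter> {b<..<nxt b} = {}" if "a \<in> A" "b \<in> A" "a \<noteq> b" for a b
      using that by (metis inf_commute linorder_neqE_linordered_idom)
  qed
  then have "(\<Sum>a\<in>A. emeasure lborel {a<..<nxt a}) = emeasure lborel (\<Union>a\<in>A. {a<..<nxt a})"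
    using \<open>finite A\<close> by (intro sum_emeasure) auto
  also have "\<dots> \<le> emeasure lborel {t\<in>{0..1}. D t > 0}"
  proof (rule emeasure_mono)
    have "{t\<in>{0..1}. D t > 0} = {0..1} \<inter> {t. 0 < D t}" by auto
    moreover have "open {t. 0 < D t}" by (intro open_Collect_less cont continuous_intros)
    ultimately show "{t\<in>{0..1}. D t > 0} \<in> sets lborel" by simp
    show "(\<Union>a\<in>A. {a<..<nxt a}) \<subseteq> {t\<in>{0..1}. D t > 0}"
    proof (intro UN_least subsetI)
      fix a t assume t: "a \<in> A" "t \<in> {a<..<nxt a}"
      then show "t \<in> {t\<in>{0..1}. D t > 0}"
        using pos[OF t] Z01 AZ[OF t(1)] nxt[OF AZ[OF t(1)]] by force
    qed
  qed
  also note meas(1)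
  finally have "ennreal (\<Sum>a\<in>A. nxt a - a) \<le> ennreal S"
    using nxt(2)[OF AZ] by (simp add: less_imp_le sum_ennreal)
  then have "(\<Sum>a\<in>A. nxt a - a) \<le> S" using \<open>S \<ge> 0\<close> by (simp add: ennreal_le_iff)
  then have len: "(\<Sum>a\<in>A. (nxt a - a)/2) \<le> S/2" by (simp flip: sum_divide_distrib)
  have "hausdorff_content \<alpha> E
      \<le> hausdorff_content \<alpha> ({t\<in>E. D t \<le> 0} \<union> (\<Union>a\<in>A. ball ((a + nxt a)/2) ((nxt a - a)/2)))"
    using hausdorff_content_mono[OF cov] hausdorff_content_Un_finite[OF \<alpha>(1) \<open>finite Z\<close>] order_trans by blast
  also have "\<dots> \<le> hausdorff_content \<alpha> {t\<in>E. D t \<le> 0} + ennreal (\<Sum>a\<in>A. ((nxt a - a)/2) powr \<alpha>)"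
    using \<open>finite A\<close> nxt(2)[OF AZ] by (intro hausdorff_content_UN_balls) (auto simp: less_imp_le)
  also have "\<dots> \<le> hausdorff_content \<alpha> {t\<in>E. D t \<le> 0}
                    + ennreal (real (k + 1) powr (1-\<alpha>) * (S/2) powr \<alpha>)"
    using \<open>finite A\<close> \<alpha> nxt(2)[OF AZ] len card
    by (intro add_left_mono ennreal_leI sum_powr_le) auto
  finally show ?thesis .
qed

section \<open>Logarithmic derivatives of polynomials on the unit circle\<close>

lemma inj_on_cis_unit_interval: "inj_on (\<lambda>t. cis (2 * pi * t)) {0..<1}"
proof (rule inj_onI)
  fix s t :: real assume st: "s \<in> {0..<1}" "t \<in> {0..<1}" "cis (2 * pi * s) = cis (2 * pi * t)"
  then have "exp (\<i> * of_real (2 * pi * s)) = exp (\<i> * of_real (2 * pi * t))"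
    by (simp add: cis_conv_exp)
  then obtain n :: int where n: "\<i> * of_real (2 * pi * s) = \<i> * of_real (2 * pi * t) + of_real (of_int (2 * n) * pi) * \<i>"
    unfolding exp_eq by blast
  then have "2 * pi * s = 2 * pi * t + of_int (2 * n) * pi"
    using n by (simp add: complex_eq_iff)
  then have "pi * (s - t) = pi * of_int n" by (simp add: algebra_simps)
  then have "s - t = of_int n" by simp
  moreover have "\<bar>s - t\<bar> < 1" using st by auto
  ultimately have "n = 0" by linarith
  then show "s = t" using \<open>s - t = of_int n\<close> by simp
qed

lemma finite_poly_cis_roots:
  assumes "R \<noteq> 0"
  shows "finite {t\<in>{0<..<1}. poly R (cis (2 * pi * t)) = 0}"
    and "card {t\<in>{0<..<1}. poly R (cis (2 * pi * t)) = 0} \<le> degree R"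
proof -
  let ?S = "{t\<in>{0<..<1}. poly R (cis (2 * pi * t)) = 0}"
  have inj: "inj_on (\<lambda>t. cis (2 * pi * t)) ?S"
    by (rule inj_on_subset[OF inj_on_cis_unit_interval]) auto
  have sub: "(\<lambda>t. cis (2 * pi * t)) ` ?S \<subseteq> {z. poly R z = 0}" by auto
  note fin = poly_roots_finite[OF assms]
  show "finite ?S" by (rule finite_imageD[OF finite_subset[OF sub fin] inj])
  have "card ?S \<le> card {z. poly R z = 0}" using inj sub fin by (rule card_inj_on_le)
  then show "card ?S \<le> degree R" using card_poly_roots_bound[OF assms] by simp
qed

section \<open>A weak type estimate for sums of Cauchy kernels\<close>

lemma Re_inverse_one_minus:
  assumes "cmod w \<le> 1" "w \<noteq> 1"
  shows "Re (1 / (1 - w)) \<ge> 0"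
proof -
  have "Re w \<le> 1" using assms complex_Re_le_cmod order_trans by blast
  then show ?thesis by (simp add: Re_divide)
qed

text \<open>The half plane \<open>Re w \<ge> 0\<close> is mapped by \<open>w / (w + y)\<close> into the disc with diameter \<open>[0, 1]\<close>.\<close>
lemma half_plane_transform:
  assumes "Re w \<ge> 0" "y > 0"
  shows "w + of_real y \<noteq> 0" "0 \<le> Re (w / (w + of_real y))" "cmod (w / (w + of_real y)) \<le> 1"
    and "y \<le> cmod w \<Longrightarrow> 1/4 \<le> Re (w / (w + of_real y))"
proof -
  show nz: "w + of_real y \<noteq> 0" using assms by (auto simp: complex_eq_iff)
  have pos: "(cmod (w + of_real y))\<^sup>2 > 0" using nz by simp
  have Re: "Re (w / (w + of_real y)) = ((cmod w)\<^sup>2 + y * Re w) / (cmod (w + of_real y))\<^sup>2"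
    by (simp add: Re_divide cmod_power2) (simp add: power2_eq_square algebra_simps)
  show "0 \<le> Re (w / (w + of_real y))" unfolding Re using assms by simp
  have sq: "(cmod (w + of_real y))\<^sup>2 = (cmod w)\<^sup>2 + 2 * y * Re w + y\<^sup>2"
    by (simp add: cmod_power2) (simp add: power2_eq_square algebra_simps)
  then have "(cmod w)\<^sup>2 \<le> (cmod (w + of_real y))\<^sup>2" using assms by simp
  then have "cmod w \<le> cmod (w + of_real y)" using abs_le_square_iff[of "cmod w" "cmod (w + of_real y)"] by simp
  then show "cmod (w / (w + of_real y)) \<le> 1"
    using nz by (simp add: norm_divide divide_le_eq_1)
  show "1/4 \<le> Re (w / (w + of_real y))" if "y \<le> cmod w"
  proof -
    have "y\<^sup>2 \<le> (cmod w)\<^sup>2" using that assms by (intro power_mono) auto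
    moreover have "y * Re w \<ge> 0" using assms by simp
    moreover have lin: "a + 2 * b + c \<le> 4 * (a + b)" if "c \<le> a" "0 \<le> b" "0 \<le> a" for a b c :: real
      using that by simp
    ultimately have "(cmod (w + of_real y))\<^sup>2 \<le> 4 * ((cmod w)\<^sup>2 + y * Re w)"
      unfolding sq mult.assoc by (intro lin) auto
    then show ?thesis unfolding Re using pos by (simp add: field_simps)
  qed
qed

text \<open>Cauchy's integral formula at the centre, that is, the mean value property.\<close>

lemma has_integral_circle_mean:
  assumes "f holomorphic_on cball 0 s" "0 < s"
  shows "((\<lambda>t. f (of_real s * cis (2 * pi * t))) has_integral f 0) {0..1}"
proof -
  have "((\<lambda>u. f u / (u - 0)) has_contour_integral (2 * of_real pi * \<i> * f 0)) (circlepath 0 s)"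
    using assms by (intro Cauchy_integral_circlepath_simple) auto
  then have "((\<lambda>t. f (circlepath 0 s t) / circlepath 0 s t * vector_derivative (circlepath 0 s) (at t))
      has_integral 2 * of_real pi * \<i> * f 0) {0..1}"
    by (simp add: has_contour_integral)
  then have "((\<lambda>t. (2 * of_real pi * \<i>) * f (of_real s * cis (2 * pi * t)))
      has_integral (2 * of_real pi * \<i>) * f 0) {0..1}"
    by (rule has_integral_eq[rotated])
      (use assms in \<open>simp only: vector_derivative_circlepath, simp add: circlepath cis_conv_exp mult_ac\<close>)
  then show ?thesis
    by (subst (asm) has_integral_mult_right_iff) auto
qed

text \<open>A weak type estimate: \<open>H / (H + y)\<close> has mean \<open>H 0 / (H 0 + y)\<close> over the circles around \<open>0\<close>,
  while its real part is nonnegative, and at least \<open>1/4\<close> where \<open>H\<close> is large.\<close>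
lemma emeasure_large_kernel_sum:
  fixes u :: "nat \<Rightarrow> complex"
  assumes u: "\<And>i. i < d \<Longrightarrow> cmod (u i) \<le> 1" and "y > 0"
    and T: "T \<in> sets borel" "T \<subseteq> {0..1}"
    and large: "\<And>t. t \<in> T \<Longrightarrow> (\<exists>i<d. u i * cis (2 * pi * t) = 1) \<or>
                  y \<le> cmod (\<Sum>i<d. 1 / (1 - u i * cis (2 * pi * t)))"
  shows "emeasure lborel T \<le> ennreal (4 * real d / y)"
proof -
  define H where "H = (\<lambda>z. \<Sum>i<d. 1 / (1 - u i * z))"
  define G where "G = (\<lambda>z. H z / (H z + of_real y))"
  \<comment> \<open>Radii increasing to 1: the kernels may have poles on the unit circle, so the
    mean is computed on smaller circles and passes to the limit by dominated convergence.\<close>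
  define s :: "nat \<Rightarrow> real" where "s = (\<lambda>k. real (Suc k) / real (Suc (Suc k)))"
  have s: "0 < s k" "s k < 1" for k by (auto simp: s_def field_simps)
  have slim: "s \<longlonglongrightarrow> 1" unfolding s_def by (rule LIMSEQ_Suc[OF LIMSEQ_n_over_Suc_n])
  \<comment> \<open>The parameters of the poles on the circle. They come from zeros of the nonzero
    polynomials \<open>u i * z - 1\<close>, so there are finitely many.\<close>
  define Q where "Q = {t\<in>{0..1}. \<exists>i<d. u i * cis (2 * pi * t) = 1}"
  have "Q \<subseteq> {0, 1} \<union> (\<Union>i<d. {t\<in>{0<..<1}. poly [:-1, u i:] (cis (2 * pi * t)) = 0})"
    by (force simp: Q_def mult.commute)
  moreover have "finite \<dots>" by (intro finite_UnI finite_UN_I finite_poly_cis_roots) auto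
  ultimately have "finite Q" by (rule finite_subset)
  then have negl: "negligible Q" by (rule negligible_finite)
  define S where "S = {0..1} - Q"
  have spike: "(f has_integral I) S" if "(f has_integral I) {0..1}" for f :: "real \<Rightarrow> real" and I
    using that by (rule has_integral_spike_set_eq[THEN iffD1, rotated -1])
      (auto simp: S_def intro: negligible_subset[OF negl])
  have ne1: "u i * z \<noteq> 1" if "cmod z < 1" "i < d" for i z
  proof -
    have "cmod (u i * z) < 1"
      using u[OF that(2)] that(1) by (simp add: norm_mult) (meson le_less_trans mult_left_le_one_le norm_ge_zero)
    then show ?thesis by auto
  qed
  have ReH: "Re (H z) \<ge> 0" if "cmod z \<le> 1" "\<forall>i<d. u i * z \<noteq> 1" for z
    unfolding H_def Re_sum
  proof (intro sum_nonneg Re_inverse_one_minus)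
    fix i assume i: "i \<in> {..<d}"
    show "u i * z \<noteq> 1" using that i by auto
    show "cmod (u i * z) \<le> 1"
      using u[of i] that(1) i by (auto simp: norm_mult intro: mult_le_one)
  qed
  have holo: "G holomorphic_on cball 0 (s k)" for k
  proof -
    have lt1: "cmod z < 1" if "z \<in> cball 0 (s k)" for z using that s[of k] by auto
    have "H holomorphic_on cball 0 (s k)"
      unfolding H_def using lt1 ne1 by (intro holomorphic_on_sum holomorphic_intros) auto
    moreover have "H z + of_real y \<noteq> 0" if "z \<in> cball 0 (s k)" for z
      using half_plane_transform(1)[OF ReH \<open>y > 0\<close>] ne1 lt1[OF that] by auto
    ultimately show ?thesis
      unfolding G_def by (intro holomorphic_on_divide holomorphic_on_add holomorphic_on_const)
  qed
  have G0: "G 0 = of_real (d / (d + y))" by (simp add: G_def H_def)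
  define g where "g = (\<lambda>k t. Re (G (of_real (s k) * cis (2 * pi * t))))"
  have int: "(g k has_integral (d / (d + y))) S" for k
  proof -
    have "(g k has_integral Re (G 0)) {0..1}"
      using has_integral_linear[OF has_integral_circle_mean[OF holo s(1)] bounded_linear_Re]
      unfolding g_def o_def .
    then have "(g k has_integral (d / (d + y))) {0..1}" by (simp add: G0)
    then show ?thesis
      by (rule spike)
  qed
  have bound: "norm (g k t) \<le> 1" for k t
  proof -
    have z: "cmod (of_real (s k) * cis (2 * pi * t)) < 1" using s[of k] by (simp add: norm_mult)
    then have "cmod (G (of_real (s k) * cis (2 * pi * t))) \<le> 1"
      unfolding G_def using half_plane_transform(3)[OF ReH \<open>y > 0\<close>] ne1 by auto
    then show ?thesis unfolding g_def real_norm_def by (rule order_trans[OF abs_Re_le_cmod])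
  qed
  have lim: "(\<lambda>k. g k t) \<longlonglongrightarrow> Re (G (cis (2 * pi * t)))" if "t \<in> S" for t
  proof -
    let ?z = "cis (2 * pi * t)"
    have ne: "\<forall>i<d. u i * ?z \<noteq> 1" using that by (auto simp: S_def Q_def)
    have "isCont H ?z" unfolding H_def using ne by (intro continuous_intros) auto
    moreover have "H ?z + of_real y \<noteq> 0"
      using half_plane_transform(1)[OF ReH \<open>y > 0\<close>] ne by auto
    ultimately have "isCont G ?z" unfolding G_def by (intro continuous_intros)
    moreover have "(\<lambda>k. of_real (s k) * ?z) \<longlonglongrightarrow> of_real 1 * ?z"
      by (intro tendsto_intros slim)
    ultimately show ?thesis
      unfolding g_def by (intro tendsto_Re isCont_tendsto_compose[where g = G]) auto
  qed
  have one: "(\<lambda>_. 1 :: real) integrable_on S"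
  proof -
    have "((\<lambda>_. 1 :: real) has_integral 1) {0..1::real}"
      using has_integral_const_real[of "1::real" 0 1] by simp
    then have "((\<lambda>_. 1 :: real) has_integral 1) S" by (rule spike)
    then show ?thesis by blast
  qed
  have dom: "(\<lambda>t. Re (G (cis (2 * pi * t)))) integrable_on S"
    "(\<lambda>k. integral S (g k)) \<longlonglongrightarrow> integral S (\<lambda>t. Re (G (cis (2 * pi * t))))"
    using dominated_convergence[of g S "\<lambda>_. 1" "\<lambda>t. Re (G (cis (2 * pi * t)))"] one int bound lim
    by auto
  have "integral S (\<lambda>t. Re (G (cis (2 * pi * t)))) = d / (d + y)"
    using LIMSEQ_unique[OF dom(2), of "d / (d + y)"] integral_unique[OF int] by simp
  also have "\<dots> \<le> d / y" using \<open>y > 0\<close> by (intro divide_left_mono) auto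
  finally have mean: "integral S (\<lambda>t. Re (G (cis (2 * pi * t)))) \<le> d / y" .
  have TQ: "T - Q \<in> sets borel" using T \<open>finite Q\<close> by (intro sets.Diff) (auto intro: finite_imp_closed borel_closed)
  have TQ': "T - Q \<in> lmeasurable"
    using T TQ by (intro bounded_set_imp_lmeasurable) (auto intro: bounded_subset[of "{0..1}"])
  have sub: "(T - Q) \<inter> S = T - Q" using T by (auto simp: S_def)
  have "measure lebesgue (T - Q) * (1/4) = integral (T - Q) (\<lambda>t. 1/4 :: real)"
    using lmeasure_integral[OF TQ'] integral_mult_left[of "T - Q" "\<lambda>_. 1::real" "1/4"] by simp
  also have "\<dots> = integral S (\<lambda>t. if t \<in> T - Q then 1/4 else 0)"
    by (simp only: integral_restrict_Int sub)
  also have "\<dots> \<le> integral S (\<lambda>t. Re (G (cis (2 * pi * t))))"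
  proof (rule integral_le)
    show "(\<lambda>t. if t \<in> T - Q then 1/4 else 0 :: real) integrable_on S"
      by (simp only: integrable_restrict_Int sub integrable_on_const[OF TQ'])
    show "(\<lambda>t. Re (G (cis (2 * pi * t)))) integrable_on S" by (rule dom(1))
    fix t assume "t \<in> S"
    then have ne: "\<forall>i<d. u i * cis (2 * pi * t) \<noteq> 1" by (auto simp: S_def Q_def)
    have Re: "Re (H (cis (2 * pi * t))) \<ge> 0" using ne by (intro ReH) auto
    show "(if t \<in> T - Q then 1/4 else 0) \<le> Re (G (cis (2 * pi * t)))"
    proof (cases "t \<in> T - Q")
      case True
      then have "y \<le> cmod (H (cis (2 * pi * t)))" using large[of t] ne by (auto simp: H_def)
      then show ?thesis
        using half_plane_transform(4)[OF Re \<open>y > 0\<close>] True by (simp add: G_def)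
    qed (use half_plane_transform(2)[OF Re \<open>y > 0\<close>] in \<open>auto simp: G_def\<close>)
  qed
  finally have mean': "measure lebesgue (T - Q) \<le> 4 * real d / y" using mean by simp
  have "emeasure lborel (T - Q) = ennreal (measure lebesgue (T - Q))"
    using TQ TQ' emeasure_eq_measure2[OF TQ'] by simp
  moreover have "emeasure lborel T \<le> emeasure lborel (T - Q) + emeasure lborel Q"
  proof -
    have Q: "Q \<in> sets borel" using \<open>finite Q\<close> by (auto intro: finite_imp_closed borel_closed)
    then have "emeasure lborel T \<le> emeasure lborel ((T - Q) \<union> Q)"
      using T Q by (intro emeasure_mono) auto
    also have "\<dots> \<le> emeasure lborel (T - Q) + emeasure lborel Q"
      using TQ Q by (intro emeasure_subadditive) auto
    finally show ?thesis .
  qed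
  moreover have "emeasure lborel Q = 0" using \<open>finite Q\<close> by (rule emeasure_lborel_countable[OF countable_finite])
  ultimately have "emeasure lborel T \<le> ennreal (measure lebesgue (T - Q))" by simp
  also have "\<dots> \<le> ennreal (4 * real d / y)" using mean' by (rule ennreal_leI)
  finally show ?thesis .
qed

text \<open>Zeros outside the unit disc are reflected in the unit circle; the conjugate kernel \<open>1 / (1 - u * z)\<close>
  dominates \<open>z / (z - w)\<close> and has nonnegative real part, so that there is no cancellation.\<close>
lemma kernel_reflection:
  fixes z w :: complex
  defines "u \<equiv> (if cmod w \<le> 1 then cnj w else inverse w)"
  assumes z: "cmod z = 1" and "z \<noteq> w"
  shows "cmod u \<le> 1"
    and "Im (1 / (1 - u * z)) = - Im (z / (z - w))"
    and "\<bar>Re (z / (z - w))\<bar> \<le> Re (1 / (1 - u * z))"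
proof -
  have zz: "z * cnj z = 1" using z complex_norm_square[of z] by simp
  have Re: "Re (z / (z - w)) = (1 - Re (z * cnj w)) / (cmod (z - w))\<^sup>2"
  proof -
    have "z / (z - w) = (z * cnj (z - w)) / of_real ((cmod (z - w))\<^sup>2)"
      by (simp add: complex_div_cnj[of z])
    also have "z * cnj (z - w) = 1 - z * cnj w" using zz by (simp add: algebra_simps)
    finally show ?thesis by (simp add: Re_divide_of_real)
  qed
  have sq: "(cmod (z - w))\<^sup>2 = 1 + (cmod w)\<^sup>2 - 2 * Re (z * cnj w)"
  proof -
    have "(cmod (z - w))\<^sup>2 = (cmod z)\<^sup>2 + (cmod w)\<^sup>2 - 2 * Re (z * cnj w)"
      by (simp add: cmod_power2) (simp add: power2_eq_square algebra_simps)
    then show ?thesis using z by simp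
  qed
  have pos: "(cmod (z - w))\<^sup>2 > 0" using \<open>z \<noteq> w\<close> by simp
  show "cmod u \<le> 1" by (auto simp: u_def norm_inverse intro: inverse_le_1_iff[THEN iffD2])
  have "Im (1 / (1 - u * z)) = - Im (z / (z - w)) \<and> \<bar>Re (z / (z - w))\<bar> \<le> Re (1 / (1 - u * z))"
  proof (cases "cmod w \<le> 1")
    case True
    have "1 / (1 - u * z) = cnj (z / (z - w))"
    proof -
      have "1 - u * z = z * cnj (z - w)" using True zz by (simp add: u_def algebra_simps)
      then have "1 / (1 - u * z) = (z * cnj z) / (z * cnj (z - w))" using zz by simp
      also have "\<dots> = cnj (z / (z - w))" using z by auto
      finally show ?thesis .
    qed
    moreover have "Re (z / (z - w)) \<ge> 0"
    proof -
      have "Re (z * cnj w) \<le> cmod (z * cnj w)" by (rule complex_Re_le_cmod)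
      also have "\<dots> \<le> 1" using z True by (simp add: norm_mult)
      finally show ?thesis unfolding Re by simp
    qed
    ultimately show ?thesis by (simp del: complex_cnj_divide)
  next
    case False
    then have "w \<noteq> 0" by auto
    have "1 / (1 - u * z) = 1 - z / (z - w)"
      using False \<open>w \<noteq> 0\<close> \<open>z \<noteq> w\<close> by (simp add: u_def divide_simps) (simp add: algebra_simps)
    \<comment> \<open>Outside the disc the two kernels sum to 1, so for
      \<open>x = Re (z / (z - w))\<close> the domination \<open>|x| \<le> 1 - x\<close> amounts to
      \<open>x \<le> 1/2\<close>.\<close>
    moreover have "Re (z / (z - w)) \<le> 1/2"
    proof -
      have "1 < (cmod w)\<^sup>2" using False by (simp add: one_less_power)
      then show ?thesis unfolding Re using pos by (simp add: divide_le_eq) (simp add: sq)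
    qed
    ultimately show ?thesis by simp
  qed
  then show "Im (1 / (1 - u * z)) = - Im (z / (z - w))"
    "\<bar>Re (z / (z - w))\<bar> \<le> Re (1 / (1 - u * z))" by auto
qed

section \<open>From kernel sums to logarithmic derivatives\<close>

lemma log_deriv_prod:
  fixes r :: "nat \<Rightarrow> complex"
  assumes "P = smult c (\<Prod>i<d. [:- r i, 1:])" "\<And>i. i < d \<Longrightarrow> z \<noteq> r i"
  shows "z * poly (pderiv P) z = poly P z * (\<Sum>i<d. z / (z - r i))"
proof -
  have "poly (pderiv P) z = c * (\<Sum>i<d. poly (\<Prod>j\<in>{..<d}-{i}. [:- r j, 1:]) z)"
    by (simp add: assms(1) pderiv_smult pderiv_prod pderiv_pCons poly_sum)
  also have "(\<Sum>i<d. poly (\<Prod>j\<in>{..<d}-{i}. [:- r j, 1:]) z)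
      = (\<Sum>i<d. (\<Prod>j<d. z - r j) / (z - r i))"
  proof (intro sum.cong refl)
    fix i assume "i \<in> {..<d}"
    then have "(\<Prod>j<d. z - r j) = (z - r i) * (\<Prod>j\<in>{..<d}-{i}. z - r j)"
      by (intro prod.remove) auto
    with \<open>i \<in> {..<d}\<close> show "poly (\<Prod>j\<in>{..<d}-{i}. [:- r j, 1:]) z = (\<Prod>j<d. z - r j) / (z - r i)"
      using assms(2)[of i] by (simp add: poly_prod)
  qed
  finally show ?thesis
    by (simp add: assms(1) poly_prod sum_distrib_left mult_ac)
qed

text \<open>Factoring \<open>P\<close> writes \<open>z * P'(z) / P(z)\<close> as the sum of the
  \<open>z / (z - r i)\<close>. After reflection its modulus is at most that of a kernel sum with
  all \<open>u i\<close> in the closed unit disc, to which the weak type estimate applies.\<close>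

lemma emeasure_large_log_deriv:
  fixes P :: "complex poly"
  assumes "P \<noteq> 0" "degree P \<le> N" "y > 0"
    and T: "T \<in> sets borel" "T \<subseteq> {0..1}"
    and large: "\<And>t. t \<in> T \<Longrightarrow>
      y * cmod (poly P (cis (2 * pi * t))) \<le> cmod (cis (2 * pi * t) * poly (pderiv P) (cis (2 * pi * t)))"
  shows "emeasure lborel T \<le> ennreal (4 * real N / y)"
proof -
  let ?d = "degree P"
  obtain r where r: "smult (lead_coeff P) (\<Prod>i<?d. [:- r i, 1:]) = P"
    using complex_poly_decompose' .
  define u where "u = (\<lambda>i. if cmod (r i) \<le> 1 then cnj (r i) else inverse (r i))"
  have "emeasure lborel T \<le> ennreal (4 * real ?d / y)"
  proof (rule emeasure_large_kernel_sum[where u = u])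
    show "cmod (u i) \<le> 1" for i by (auto simp: u_def norm_inverse intro: inverse_le_1_iff[THEN iffD2])
    fix t assume "t \<in> T"
    define z where "z = cis (2 * pi * t)"
    have z: "cmod z = 1" by (simp add: z_def)
    show "(\<exists>i<?d. u i * cis (2 * pi * t) = 1) \<or> y \<le> cmod (\<Sum>i<?d. 1 / (1 - u i * cis (2 * pi * t)))"
    proof (cases "\<exists>i<?d. z = r i")
      case True
      \<comment> \<open>At a zero of \<open>P\<close> on the circle, \<open>u i\<close> is its
        conjugate and thus its inverse: the pole allowed by the first alternative.\<close>
      then have "u i * z = 1" if "z = r i" for i
        using z that complex_norm_square[of z] by (simp add: u_def mult.commute)
      then show ?thesis using True by (auto simp: z_def)
    next
      case False
      then have ne: "z \<noteq> r i" if "i < ?d" for i using that by auto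
      define X where "X = (\<Sum>i<?d. z / (z - r i))"
      define Y where "Y = (\<Sum>i<?d. 1 / (1 - u i * z))"
      have Im: "Im Y = - Im X"
        unfolding X_def Y_def Im_sum sum_negf[symmetric]
        by (intro sum.cong) (use kernel_reflection(2)[OF z ne] in \<open>auto simp: u_def\<close>)
      have "\<bar>Re X\<bar> \<le> (\<Sum>i<?d. \<bar>Re (z / (z - r i))\<bar>)"
        unfolding X_def Re_sum by (rule sum_abs)
      also have "\<dots> \<le> Re Y"
        unfolding Y_def Re_sum
        by (intro sum_mono) (use kernel_reflection(3)[OF z ne] in \<open>auto simp: u_def\<close>)
      finally have "(Re X)\<^sup>2 \<le> (Re Y)\<^sup>2" by (intro abs_le_square_iff[THEN iffD1]) auto
      then have XY: "cmod X \<le> cmod Y" using Im by (simp add: cmod_def)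
      have Pz: "poly P z \<noteq> 0"
        using ne assms(1) by (subst r[symmetric]) (auto simp: poly_prod)
      have "y * cmod (poly P z) \<le> cmod (poly P z) * cmod X"
        using large[OF \<open>t \<in> T\<close>] log_deriv_prod[OF r[symmetric] ne]
        unfolding X_def z_def by (simp add: norm_mult)
      then have "y \<le> cmod X" using Pz by (simp add: mult.commute)
      then show ?thesis using XY by (simp add: Y_def z_def)
    qed
  qed (use assms in auto)
  also have "\<dots> \<le> ennreal (4 * real N / y)"
    using assms by (intro ennreal_leI divide_right_mono) auto
  finally show ?thesis .
qed

text \<open>The conjugate reciprocal polynomial: on the unit circle \<open>cnj z\<close> is
  \<open>1/z\<close>, so multiplication by \<open>z ^ N\<close> makes the conjugate of
  \<open>P\<close> a polynomial. Squared moduli thereby become polynomials whose zeros can be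
  counted.\<close>

lemma poly_reflect_circle:
  fixes P :: "complex poly"
  assumes "degree P \<le> N"
  obtains Q where "degree Q \<le> N" "\<And>z. cmod z = 1 \<Longrightarrow> poly Q z = z ^ N * cnj (poly P z)"
proof
  define Q where "Q = (\<Sum>i\<le>N. monom (cnj (coeff P i)) (N - i))"
  show "degree Q \<le> N"
    unfolding Q_def by (intro degree_sum_le) (auto intro: order_trans[OF degree_monom_le])
  fix z :: complex assume z: "cmod z = 1"
  have P: "poly P z = (\<Sum>i\<le>N. coeff P i * z ^ i)"
    unfolding poly_altdef using assms
    by (intro sum.mono_neutral_left) (auto simp: coeff_eq_0)
  have "z ^ (N - i) = z ^ N * cnj z ^ i" if "i \<le> N" for i
  proof -
    have "z ^ N * cnj z ^ i = z ^ (N - i) * (z * cnj z) ^ i"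
      using that by (simp add: power_mult_distrib mult.assoc flip: power_add)
    then show ?thesis using z complex_norm_square[of z] by simp
  qed
  then show "poly Q z = z ^ N * cnj (poly P z)"
    by (simp add: Q_def P poly_sum poly_monom sum_distrib_left mult_ac)
qed

text \<open>On the circle, \<open>z ^ N\<close> times the difference of \<open>|P'|^2\<close> and
  \<open>y^2 * |P|^2\<close> is a polynomial of degree at most \<open>2 * N\<close>. Unless it
  vanishes identically, this bounds the number of sign changes, while the estimate of the
  logarithmic derivative bounds the measure of the removed set by \<open>4 * N / y\<close>.\<close>

lemma hausdorff_content_small_log_deriv:
  fixes P :: "complex poly"
  assumes \<alpha>: "0 < \<alpha>" "\<alpha> < 1" and E: "E \<subseteq> {0..1}" and N: "degree P \<le> N" "N \<ge> 1" and "y > 0"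
  shows "hausdorff_content \<alpha> E
    \<le> hausdorff_content \<alpha> {t\<in>E. cmod (poly (pderiv P) (cis (2 * pi * t))) \<le> y * cmod (poly P (cis (2 * pi * t)))}
       + ennreal (4 * real N * y powr - \<alpha>)"
proof -
  define D where "D = (\<lambda>t. (cmod (poly (pderiv P) (cis (2 * pi * t))))\<^sup>2 - (y * cmod (poly P (cis (2 * pi * t))))\<^sup>2)"
  have D_iff: "D t \<le> 0 \<longleftrightarrow> cmod (poly (pderiv P) (cis (2 * pi * t))) \<le> y * cmod (poly P (cis (2 * pi * t)))" for t
    unfolding D_def using \<open>y > 0\<close> by (simp add: power2_le_iff_abs_le abs_mult flip: abs_le_square_iff)
  have cont: "continuous_on UNIV D"
    unfolding D_def cis_conv_exp by (intro continuous_intros)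
  define S where "S = [:0, 1:] * pderiv P"
  have S: "poly S z = z * poly (pderiv P) z" for z by (simp add: S_def)
  have "degree S \<le> N"
  proof (cases "degree P = 0")
    case True
    then show ?thesis by (simp add: S_def pderiv_eq_0_iff[THEN iffD2])
  next
    case False
    have "degree S \<le> 1 + degree (pderiv P)"
      unfolding S_def using degree_mult_le[of "[:0, 1:]" "pderiv P"] by simp
    then show ?thesis using N False by (simp add: degree_pderiv)
  qed
  then obtain S' where S': "degree S' \<le> N" "\<And>z. cmod z = 1 \<Longrightarrow> poly S' z = z ^ N * cnj (poly S z)"
    using poly_reflect_circle by metis
  obtain P' where P': "degree P' \<le> N" "\<And>z. cmod z = 1 \<Longrightarrow> poly P' z = z ^ N * cnj (poly P z)"
    using poly_reflect_circle N(1) by metis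
  define R where "R = S * S' - smult (of_real (y\<^sup>2)) (P * P')"
  have R: "poly R z = z ^ N * of_real (D t)" if "z = cis (2 * pi * t)" for z t
  proof -
    have z: "cmod z = 1" using that by simp
    have sq: "poly p z * (z ^ N * cnj (poly p z)) = z ^ N * of_real ((cmod (poly p z))\<^sup>2)" for p
      by (simp only: complex_norm_square mult_ac)
    have "poly R z = z ^ N * of_real ((cmod (poly S z))\<^sup>2) - of_real (y\<^sup>2) * (z ^ N * of_real ((cmod (poly P z))\<^sup>2))"
      by (simp only: R_def poly_diff poly_mult poly_smult S'(2)[OF z] P'(2)[OF z] sq)
    also have "\<dots> = z ^ N * of_real (D t)"
      using z that by (simp add: D_def S norm_mult power_mult_distrib algebra_simps)
    finally show ?thesis .
  qed
  have degR: "degree R \<le> 2 * N"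
    unfolding R_def
  proof (rule degree_diff_le)
    show "degree (S * S') \<le> 2 * N"
      using degree_mult_le[of S S'] \<open>degree S \<le> N\<close> S'(1) by linarith
    show "degree (smult (of_real (y\<^sup>2)) (P * P')) \<le> 2 * N"
      using degree_mult_le[of P P'] degree_smult_le[of "of_real (y\<^sup>2)" "P * P'"] N P'(1) by linarith
  qed
  show ?thesis
  proof (cases "R = 0")
    case True
    then have "D t = 0" for t using R[OF refl, of t] by simp
    then have "{t\<in>E. D t \<le> 0} = E" by auto
    then show ?thesis unfolding D_iff by simp
  next
    case False
    then have "P \<noteq> 0" by (auto simp: R_def S_def)
    have zeros: "{t\<in>{0<..<1}. D t = 0} = {t\<in>{0<..<1}. poly R (cis (2 * pi * t)) = 0}"
      using R[OF refl] by auto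
    have "hausdorff_content \<alpha> E \<le> hausdorff_content \<alpha> {t\<in>E. D t \<le> 0}
        + ennreal (real (2 * N + 1) powr (1-\<alpha>) * ((4 * real N / y)/2) powr \<alpha>)"
    proof (rule hausdorff_content_remove_positivity_set[OF \<alpha> E cont])
      show "finite {t\<in>{0<..<1}. D t = 0}" "card {t\<in>{0<..<1}. D t = 0} \<le> 2 * N"
        unfolding zeros using finite_poly_cis_roots[OF False] degR by auto
      show "emeasure lborel {t\<in>{0..1}. D t > 0} \<le> ennreal (4 * real N / y)"
      proof (rule emeasure_large_log_deriv[OF \<open>P \<noteq> 0\<close> N(1) \<open>y > 0\<close>])
        have "{t\<in>{0..1}. D t > 0} = {0..1} \<inter> {t. 0 < D t}" by auto
        moreover have "open {t. 0 < D t}" by (intro open_Collect_less cont continuous_intros)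
        ultimately show "{t\<in>{0..1}. D t > 0} \<in> sets borel" by simp
        fix t assume "t \<in> {t\<in>{0..1}. D t > 0}"
        then show "y * cmod (poly P (cis (2 * pi * t)))
            \<le> cmod (cis (2 * pi * t) * poly (pderiv P) (cis (2 * pi * t)))"
          using D_iff[of t] by (simp add: norm_mult)
      qed auto
    qed (use \<open>y > 0\<close> in auto)
    \<comment> \<open>As \<open>N \<ge> 1\<close>, \<open>2 * N + 1 \<le> 4 * N\<close>. With
      \<open>4 * N\<close> in both bases the exponents \<open>1 - \<alpha>\<close> and
      \<open>\<alpha>\<close> add up to one.\<close>
    also have "real (2 * N + 1) powr (1-\<alpha>) * ((4 * real N / y)/2) powr \<alpha>
        \<le> (4 * real N) powr (1-\<alpha>) * (4 * real N / y) powr \<alpha>"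
      using \<alpha> N \<open>y > 0\<close> by (intro mult_mono powr_mono2) (auto intro!: divide_right_mono)
    also have "\<dots> = 4 * real N * y powr - \<alpha>"
      using \<alpha> N \<open>y > 0\<close> by (simp add: powr_divide powr_diff powr_minus field_simps)
    finally show ?thesis unfolding D_iff by (simp add: add_left_mono ennreal_leI)
  qed
qed

section \<open>The upper bound\<close>

text \<open>Multiplication by \<open>cis (- (2 * pi * a * t))\<close> keeps moduli and turns the sum
  into a polynomial in \<open>cis (2 * pi * t)\<close> of degree at most \<open>N\<close>. Then
  \<open>z * P'(z)\<close> weights the coefficients by \<open>m - a\<close>, which kills the
  frequency \<open>a\<close>.\<close>

lemma hausdorff_content_small_derivative:
  fixes M :: "int set" and c :: "int \<Rightarrow> complex"
  assumes \<alpha>: "0 < \<alpha>" "\<alpha> < 1" and E: "E \<subseteq> {0..1}"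
    and M: "finite M" "M \<subseteq> {a..a + int N}" and "N \<ge> 1" "y > 0"
  shows "hausdorff_content \<alpha> E
    \<le> hausdorff_content \<alpha> {t\<in>E. cmod (\<Sum>m\<in>M. of_int (m - a) * c m * cis (2 * pi * of_int m * t))
                                 \<le> y * cmod (\<Sum>m\<in>M. c m * cis (2 * pi * of_int m * t))}
       + ennreal (4 * real N * y powr - \<alpha>)"
proof -
  define P where "P = (\<Sum>m\<in>M. monom (c m) (nat (m - a)))"
  have deg: "degree P \<le> N"
    unfolding P_def
  proof (intro degree_sum_le M(1))
    fix m assume "m \<in> M"
    then have "m \<le> a + int N" using M(2) by auto
    then have "nat (m - a) \<le> N" by linarith
    then show "degree (monom (c m) (nat (m - a))) \<le> N" using degree_monom_le order_trans by blast
  qed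
  have pow: "cis (2 * pi * t) ^ nat (m - a) = cis (- (2 * pi * of_int a * t)) * cis (2 * pi * of_int m * t)"
    if "m \<in> M" for m t
  proof -
    have "real (nat (m - a)) = of_int m - of_int a" using that M(2) by auto
    then have "cis (2 * pi * t) ^ nat (m - a) = cis ((of_int m - of_int a) * (2 * pi * t))"
      by (simp only: Complex.DeMoivre)
    then show ?thesis by (simp add: cis_mult algebra_simps)
  qed
  have P: "cmod (poly P (cis (2 * pi * t))) = cmod (\<Sum>m\<in>M. c m * cis (2 * pi * of_int m * t))" for t
  proof -
    have "poly P (cis (2 * pi * t))
        = cis (- (2 * pi * of_int a * t)) * (\<Sum>m\<in>M. c m * cis (2 * pi * of_int m * t))"
      unfolding P_def poly_sum poly_monom sum_distrib_left
      by (intro sum.cong refl) (simp only: pow, simp only: mult_ac)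
    then show ?thesis by (simp add: norm_mult)
  qed
  have P': "cmod (poly (pderiv P) (cis (2 * pi * t)))
      = cmod (\<Sum>m\<in>M. of_int (m - a) * c m * cis (2 * pi * of_int m * t))" for t
  proof -
    let ?z = "cis (2 * pi * t)"
    have "?z * poly (pderiv P) ?z = (\<Sum>m\<in>M. of_int (m - a) * c m * ?z ^ nat (m - a))"
      unfolding P_def higher_pderiv_sum[of 1, simplified] poly_sum sum_distrib_left pderiv_monom poly_monom
    proof (intro sum.cong refl)
      fix m assume "m \<in> M"
      then have "m - a \<ge> 0" using M(2) by auto
      then have "of_nat (nat (m - a)) = (of_int (m - a) :: complex)" by simp
      \<comment> \<open>For \<open>m = a\<close> the exponent on the left is a truncated
        \<open>0 - 1\<close>; the vanishing factor in front makes this harmless.\<close>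
      then show "?z * (of_nat (nat (m - a)) * c m * ?z ^ (nat (m - a) - 1))
          = of_int (m - a) * c m * ?z ^ nat (m - a)"
        by (cases "nat (m - a)") auto
    qed
    also have "\<dots> = cis (- (2 * pi * of_int a * t)) * (\<Sum>m\<in>M. of_int (m - a) * c m * cis (2 * pi * of_int m * t))"
      unfolding sum_distrib_left by (intro sum.cong refl) (simp only: pow, simp only: mult_ac)
    finally have "cmod (?z * poly (pderiv P) ?z)
        = cmod (cis (- (2 * pi * of_int a * t)) * (\<Sum>m\<in>M. of_int (m - a) * c m * cis (2 * pi * of_int m * t)))"
      by simp
    then show ?thesis by (simp add: norm_mult)
  qed
  show ?thesis
    using hausdorff_content_small_log_deriv[OF \<alpha> E deg \<open>N \<ge> 1\<close> \<open>y > 0\<close>] unfolding P P' .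
qed

text \<open>Complex conjugation negates the frequencies and keeps the moduli, so the upper end
  \<open>b\<close> of the spectrum becomes the lower end \<open>- b\<close> in the previous
  estimate.\<close>

lemma hausdorff_content_small_derivative_rev:
  fixes M :: "int set" and c :: "int \<Rightarrow> complex"
  assumes \<alpha>: "0 < \<alpha>" "\<alpha> < 1" and E: "E \<subseteq> {0..1}"
    and M: "finite M" "M \<subseteq> {b - int N..b}" and "N \<ge> 1" "y > 0"
  shows "hausdorff_content \<alpha> E
    \<le> hausdorff_content \<alpha> {t\<in>E. cmod (\<Sum>m\<in>M. of_int (b - m) * c m * cis (2 * pi * of_int m * t))
                                 \<le> y * cmod (\<Sum>m\<in>M. c m * cis (2 * pi * of_int m * t))}
       + ennreal (4 * real N * y powr - \<alpha>)"
proof -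
  define c' where "c' = (\<lambda>m. cnj (c (- m)))"
  have conj: "cmod (\<Sum>m\<in>uminus ` M. d (- m) * cnj (c (- m)) * cis (2 * pi * of_int m * t))
      = cmod (\<Sum>m\<in>M. d m * c m * cis (2 * pi * of_int m * t))"
    if d: "\<And>m. cnj (d m) = d m" for d t
  proof -
    have "(\<Sum>m\<in>uminus ` M. d (- m) * cnj (c (- m)) * cis (2 * pi * of_int m * t))
        = cnj (\<Sum>m\<in>M. d m * c m * cis (2 * pi * of_int m * t))"
      by (subst sum.reindex) (auto simp: d cis_cnj)
    then show ?thesis by (simp only: complex_mod_cnj)
  qed
  have "hausdorff_content \<alpha> E
    \<le> hausdorff_content \<alpha> {t\<in>E. cmod (\<Sum>m\<in>uminus ` M. of_int (m - (- b)) * c' m * cis (2 * pi * of_int m * t))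
                                 \<le> y * cmod (\<Sum>m\<in>uminus ` M. c' m * cis (2 * pi * of_int m * t))}
       + ennreal (4 * real N * y powr - \<alpha>)"
    using assms by (intro hausdorff_content_small_derivative) auto
  moreover have "cmod (\<Sum>m\<in>uminus ` M. of_int (m - (- b)) * c' m * cis (2 * pi * of_int m * t))
      = cmod (\<Sum>m\<in>M. of_int (b - m) * c m * cis (2 * pi * of_int m * t))" for t
    using conj[of "\<lambda>m. of_int (b - m)" t] by (simp add: c'_def add.commute)
  moreover have "cmod (\<Sum>m\<in>uminus ` M. c' m * cis (2 * pi * of_int m * t))
      = cmod (\<Sum>m\<in>M. c m * cis (2 * pi * of_int m * t))" for t
    using conj[of "\<lambda>_. 1" t] by (simp add: c'_def)
  ultimately show ?thesis by simp
qed

text \<open>Differentiation, after a shift of the frequencies that makes the smallest or the largest of them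
  vanish, removes one frequency. One of the two choices increases the sum of the moduli of the
  coefficients at least by half the length of the spectrum, and by the estimate of the logarithmic derivative it
  increases the polynomial only moderately away from a set of content \<open>\<delta>\<close>.\<close>
lemma sum_norm_coeffs_le:
  fixes M :: "int set" and c :: "int \<Rightarrow> complex"
  assumes \<alpha>: "0 < \<alpha>" "\<alpha> < 1" and "\<delta> > 0"
    and "finite M" "card M = Suc k" "M \<subseteq> {l..l + int N}"
    and "E \<subseteq> {0..1}" "ennreal (real k * \<delta>) < hausdorff_content \<alpha> E"
    and "\<And>t. t \<in> E \<Longrightarrow> cmod (\<Sum>m\<in>M. c m * cis (2 * pi * of_int m * t)) \<le> B"
  shows "(\<Sum>m\<in>M. cmod (c m)) \<le> (2 * (4/\<delta>) powr (1/\<alpha>) * real N powr (1/\<alpha> - 1)) ^ k * B"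
  using assms(4-)
proof (induction k arbitrary: M c E B)
  case 0
  then obtain m where M: "M = {m}" by (metis One_nat_def card_1_singletonE)
  have "E \<noteq> {}" using 0(5) hausdorff_content_empty by auto
  then obtain t where "t \<in> E" by auto
  with 0(6)[OF this] show ?case by (simp add: M norm_mult)
next
  case (Suc k)
  define K where "K = 2 * (4/\<delta>) powr (1/\<alpha>) * real N powr (1/\<alpha> - 1)"
  define a where "a = Min M"
  define b where "b = Max M"
  have "M \<noteq> {}" using Suc.prems(2) by auto
  then have abM: "a \<in> M" "b \<in> M" using Suc.prems(1) by (auto simp: a_def b_def)
  have M_ab: "m \<in> {a..b}" if "m \<in> M" for m using Suc.prems(1) that by (auto simp: a_def b_def)
  have "a \<noteq> b"
  proof
    assume "a = b"
    then have "M \<subseteq> {a}" using M_ab by auto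
    then have "card M \<le> 1" using card_mono[of "{a}" M] by simp
    then show False using Suc.prems(2) by simp
  qed
  then have "a < b" using M_ab[OF abM(1)] by auto
  define L where "L = nat (b - a)"
  have L: "1 \<le> L" "int L = b - a" using \<open>a < b\<close> by (auto simp: L_def)
  have "l \<le> a" "b \<le> l + int N" using abM Suc.prems(3) by auto
  then have "L \<le> N" using L(2) by linarith
  \<comment> \<open>Chosen so that the bound for the content lost in this step is exactly
    \<open>\<delta>\<close>.\<close>
  define y where "y = (4 * real L / \<delta>) powr (1/\<alpha>)"
  have "y > 0" using L(1) \<open>\<delta> > 0\<close> by (simp add: y_def)
  have small: "4 * real L * y powr - \<alpha> = \<delta>"
    using L(1) \<open>\<delta> > 0\<close> \<alpha> by (simp add: y_def powr_powr powr_minus_divide)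
  \<comment> \<open>One step costs a factor \<open>y\<close> in the bound for the polynomial and
    gains \<open>L / 2\<close> in the coefficients. As \<open>1/\<alpha> - 1\<close> is nonnegative,
    the actual length \<open>L\<close> may be replaced by \<open>N\<close>.\<close>
  have yK: "2 * y / real L \<le> K"
  proof -
    have "y = (4/\<delta>) powr (1/\<alpha>) * real L powr (1/\<alpha>)"
      using L(1) \<open>\<delta> > 0\<close> by (simp add: y_def flip: powr_mult)
    then have "2 * y / real L = 2 * (4/\<delta>) powr (1/\<alpha>) * real L powr (1/\<alpha> - 1)"
      using L(1) by (simp add: powr_diff)
    also have "\<dots> \<le> K"
      unfolding K_def using \<alpha> \<open>L \<le> N\<close> by (intro mult_left_mono powr_mono2) auto
    finally show ?thesis .
  qed
  have "E \<noteq> {}" using Suc.prems(5) hausdorff_content_empty by auto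
  then have "B \<ge> 0" using Suc.prems(6) norm_ge_zero order_trans by blast
  \<comment> \<open>Covers both choices at once: \<open>w\<close> is the distance to the end
    \<open>e\<close> of the spectrum, \<open>m - a\<close> for \<open>e = a\<close> or
    \<open>b - m\<close> for \<open>e = b\<close>.\<close>
  have step: "(\<Sum>m\<in>M. cmod (c m)) \<le> K ^ Suc k * B"
    if e: "e \<in> M" "w e = 0" and w: "\<And>m. m \<in> M \<Longrightarrow> 0 \<le> w m"
      and content: "hausdorff_content \<alpha> E
        \<le> hausdorff_content \<alpha> {t\<in>E. cmod (\<Sum>m\<in>M. of_int (w m) * c m * cis (2 * pi * of_int m * t))
                                     \<le> y * cmod (\<Sum>m\<in>M. c m * cis (2 * pi * of_int m * t))}
           + ennreal (4 * real L * y powr - \<alpha>)"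
      and large: "real L * (\<Sum>m\<in>M. cmod (c m)) \<le> 2 * (\<Sum>m\<in>M. of_int (w m) * cmod (c m))"
    for e w
  proof -
    let ?E = "{t\<in>E. cmod (\<Sum>m\<in>M. of_int (w m) * c m * cis (2 * pi * of_int m * t))
                      \<le> y * cmod (\<Sum>m\<in>M. c m * cis (2 * pi * of_int m * t))}"
    have "ennreal (real k * \<delta>) + ennreal \<delta> < hausdorff_content \<alpha> ?E + ennreal \<delta>"
    proof -
      have "ennreal (real k * \<delta>) + ennreal \<delta> = ennreal (real (Suc k) * \<delta>)"
        using \<open>\<delta> > 0\<close> by (simp add: algebra_simps flip: ennreal_plus)
      also have "\<dots> < hausdorff_content \<alpha> E" by (rule Suc.prems(5))
      also have "\<dots> \<le> hausdorff_content \<alpha> ?E + ennreal \<delta>" using content unfolding small .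
      finally show ?thesis .
    qed
    then have content': "ennreal (real k * \<delta>) < hausdorff_content \<alpha> ?E"
      by (meson add_right_mono leD leI)
    have "(\<Sum>m\<in>M - {e}. cmod (of_int (w m) * c m)) \<le> K ^ k * (y * B)"
      unfolding K_def
    proof (rule Suc.IH)
      show "finite (M - {e})" "card (M - {e}) = Suc k" "M - {e} \<subseteq> {l..l + int N}"
        using Suc.prems e by auto
      show "?E \<subseteq> {0..1}" using Suc.prems(4) by auto
      show "ennreal (real k * \<delta>) < hausdorff_content \<alpha> ?E" by (rule content')
      fix t assume t: "t \<in> ?E"
      have "(\<Sum>m\<in>M - {e}. of_int (w m) * c m * cis (2 * pi * of_int m * t))
          = (\<Sum>m\<in>M. of_int (w m) * c m * cis (2 * pi * of_int m * t))"
        using Suc.prems(1) e by (intro sum.mono_neutral_left) auto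
      also have "cmod \<dots> \<le> y * cmod (\<Sum>m\<in>M. c m * cis (2 * pi * of_int m * t))" using t by simp
      also have "\<dots> \<le> y * B" using t Suc.prems(6)[of t] \<open>y > 0\<close> by (intro mult_left_mono) auto
      finally show "cmod (\<Sum>m\<in>M - {e}. of_int (w m) * c m * cis (2 * pi * of_int m * t)) \<le> y * B" .
    qed
    also have "(\<Sum>m\<in>M - {e}. cmod (of_int (w m) * c m)) = (\<Sum>m\<in>M. of_int (w m) * cmod (c m))"
      using Suc.prems(1) e w by (intro sum.mono_neutral_cong_left) (auto simp: norm_mult)
    finally have "real L * (\<Sum>m\<in>M. cmod (c m)) \<le> 2 * (K ^ k * (y * B))" using large by linarith
    then have "(\<Sum>m\<in>M. cmod (c m)) \<le> (2 * y / real L) * (K ^ k * B)"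
      using L(1) by (simp add: field_simps)
    also have "\<dots> \<le> K * (K ^ k * B)"
      using \<open>B \<ge> 0\<close> by (intro mult_right_mono yK) (auto simp: K_def)
    finally show ?thesis by (simp add: mult_ac)
  qed
  \<comment> \<open>The two weights add up to \<open>L\<close> at each frequency, so the larger sum
    is at least \<open>L / 2\<close> times the sum of the moduli.\<close>
  define S1 where "S1 = (\<Sum>m\<in>M. of_int (m - a) * cmod (c m))"
  define S2 where "S2 = (\<Sum>m\<in>M. of_int (b - m) * cmod (c m))"
  have "S1 + S2 = (\<Sum>m\<in>M. real L * cmod (c m))"
    unfolding S1_def S2_def sum.distrib[symmetric]
  proof (intro sum.cong refl)
    have "real L = of_int (b - a)" using L(2) by (metis of_int_of_nat_eq)
    then have "of_int (m - a) + of_int (b - m) = real L" for m by simp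
    then show "of_int (m - a) * cmod (c m) + of_int (b - m) * cmod (c m) = real L * cmod (c m)" for m
      by (metis distrib_right)
  qed
  then have S12: "S1 + S2 = real L * (\<Sum>m\<in>M. cmod (c m))" by (simp add: sum_distrib_left)
  have M1: "M \<subseteq> {a..a + int L}" and M2: "M \<subseteq> {b - int L..b}" using M_ab L(2) by auto
  show ?case
  proof (cases "S2 \<le> S1")
    case True
    then have "real L * (\<Sum>m\<in>M. cmod (c m)) \<le> 2 * S1" using S12 by simp
    then show ?thesis
      using abM M_ab hausdorff_content_small_derivative[OF \<alpha> Suc.prems(4,1) M1 L(1) \<open>y > 0\<close>]
      unfolding S1_def K_def[symmetric] by (intro step[of a "\<lambda>m. m - a"]) auto
  next
    case False
    then have "real L * (\<Sum>m\<in>M. cmod (c m)) \<le> 2 * S2" using S12 by simp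
    then show ?thesis
      using abM M_ab hausdorff_content_small_derivative_rev[OF \<alpha> Suc.prems(4,1) M2 L(1) \<open>y > 0\<close>]
      unfolding S2_def K_def[symmetric] by (intro step[of b "\<lambda>m. b - m"]) auto
  qed
qed

section \<open>From sets of frequencies to trigonometric polynomials\<close>

lemma trig_poly_cis: "trig_poly n c m t = (\<Sum>k=1..n. c k * cis (2 * pi * of_int (m k) * t))"
  unfolding trig_poly_def cis_conv_exp by (intro sum.cong refl) (simp add: mult_ac)

lemma norm_trig_poly_le: "cmod (trig_poly n c m t) \<le> (\<Sum>k=1..n. cmod (c k))"
  unfolding trig_poly_cis by (rule order_trans[OF norm_sum]) (simp add: norm_mult)

lemma bdd_above_norm_trig_poly: "bdd_above ((\<lambda>t. cmod (trig_poly n c m t)) ` E)"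
  using norm_trig_poly_le by (intro bdd_aboveI2)

text \<open>Half of the content is spent evenly on the \<open>n - 1\<close> steps of the coefficient
  estimate, and the polynomial is bounded by the sum of the moduli of its coefficients.\<close>

lemma Sup_norm_trig_poly_le:
  assumes \<alpha>: "0 < \<alpha>" "\<alpha> < 1" and E: "E \<subseteq> {0..1}" "hausdorff_content \<alpha> E > 0"
    and n: "n \<ge> 1" and m: "strict_mono_on {1..n} m"
  shows "(SUP t\<in>{0..1}. cmod (trig_poly n c m t))
     \<le> ((16 * (real n - 1) / enn2real (hausdorff_content \<alpha> E)) powr (1/\<alpha>)
           * real_of_int (m n - m 1) powr (1/\<alpha> - 1)) ^ (n - 1)
         * (SUP t\<in>E. cmod (trig_poly n c m t))"
proof -
  define h where "h = enn2real (hausdorff_content \<alpha> E)"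
  have "hausdorff_content \<alpha> E \<le> 1" by (rule hausdorff_content_unit_interval_le_1[OF E(1)])
  then have h: "hausdorff_content \<alpha> E = ennreal h" "h > 0"
    using E(2) by (auto simp: h_def enn2real_positive_iff ennreal_enn2real_if top_unique intro: le_less_trans)
  \<comment> \<open>For \<open>n = 1\<close> no content is spent and the quotient would divide by
    zero; any positive value serves.\<close>
  define \<delta> where "\<delta> = (if n = 1 then 1 else h / (2 * (real n - 1)))"
  have "\<delta> > 0" using h n by (auto simp: \<delta>_def)
  define B where "B = (SUP t\<in>E. cmod (trig_poly n c m t))"
  have B: "cmod (trig_poly n c m t) \<le> B" if "t \<in> E" for t
    unfolding B_def by (rule cSUP_upper[OF that bdd_above_norm_trig_poly])
  have "E \<noteq> {}" using E(2) hausdorff_content_empty by auto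
  then have "B \<ge> 0" using B norm_ge_zero order_trans by blast
  have inj: "inj_on m {1..n}" using m by (rule strict_mono_on_imp_inj_on)
  define c' where "c' = (\<lambda>j. c (the_inv_into {1..n} m j))"
  have c': "c' (m k) = c k" if "k \<in> {1..n}" for k
    using that inj by (simp add: c'_def the_inv_into_f_f)
  have mono: "m 1 \<le> m k" "m k \<le> m n" if "k \<in> {1..n}" for k
    using that n m strict_mono_on_leD[OF m] by auto
  have "(\<Sum>j\<in>m ` {1..n}. cmod (c' j))
      \<le> (2 * (4/\<delta>) powr (1/\<alpha>) * real (nat (m n - m 1)) powr (1/\<alpha> - 1)) ^ (n - 1) * B"
  proof (rule sum_norm_coeffs_le[OF \<alpha> \<open>\<delta> > 0\<close> _ _ _ E(1)])
    show "card (m ` {1..n}) = Suc (n - 1)" using n inj by (simp add: card_image)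
    show "m ` {1..n} \<subseteq> {m 1..m 1 + int (nat (m n - m 1))}" using mono n by auto
    have "real (n - 1) * \<delta> \<le> h / 2"
      using h(2) n by (cases "n = 1") (auto simp: \<delta>_def of_nat_diff field_simps)
    then show "ennreal (real (n - 1) * \<delta>) < hausdorff_content \<alpha> E"
      unfolding h(1) using h(2) by (intro ennreal_lessI) auto
    fix t assume "t \<in> E"
    moreover have "(\<Sum>j\<in>m ` {1..n}. c' j * cis (2 * pi * of_int j * t)) = trig_poly n c m t"
      unfolding trig_poly_cis by (subst sum.reindex[OF inj]) (auto intro!: sum.cong simp: c')
    ultimately show "cmod (\<Sum>j\<in>m ` {1..n}. c' j * cis (2 * pi * of_int j * t)) \<le> B"
      using B by simp
  qed simp
  also have "(\<Sum>j\<in>m ` {1..n}. cmod (c' j)) = (\<Sum>k=1..n. cmod (c k))"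
    by (subst sum.reindex[OF inj]) (auto intro!: sum.cong simp: c')
  also have "real (nat (m n - m 1)) = real_of_int (m n - m 1)" using mono(1)[of n] n by simp
  also have "(2 * (4/\<delta>) powr (1/\<alpha>) * real_of_int (m n - m 1) powr (1/\<alpha> - 1)) ^ (n - 1) * B
      \<le> ((16 * (real n - 1) / h) powr (1/\<alpha>) * real_of_int (m n - m 1) powr (1/\<alpha> - 1)) ^ (n - 1) * B"
  proof (cases "n = 1")
    case False
    then have n1: "real n - 1 > 0" using n by simp
    \<comment> \<open>The factor 2 is absorbed using \<open>2 \<le> 2 powr (1/\<alpha>)\<close>;
      with the 4 and the halved content this gives the constant 16.\<close>
    have "2 * (4/\<delta>) powr (1/\<alpha>) \<le> 2 powr (1/\<alpha>) * (4/\<delta>) powr (1/\<alpha>)"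
      using \<alpha> powr_mono[of 1 "1/\<alpha>" 2] by (intro mult_right_mono) auto
    also have "\<dots> = (2 * (4/\<delta>)) powr (1/\<alpha>)"
      using \<open>\<delta> > 0\<close> by (simp flip: powr_mult)
    also have "2 * (4/\<delta>) = 16 * (real n - 1) / h"
      using False n1 h(2) by (simp add: \<delta>_def field_simps)
    finally show ?thesis
      using \<open>B \<ge> 0\<close> by (intro mult_right_mono power_mono) auto
  qed simp
  finally have "(\<Sum>k=1..n. cmod (c k)) \<le> \<dots>" .
  then show ?thesis
    unfolding h_def B_def by (intro cSUP_least) (auto intro: order_trans[OF norm_trig_poly_le])
qed

section \<open>Sharpness\<close>

text \<open>By the inverse Hoelder condition the preimage of a ball of radius \<open>r\<close> lies
  in an interval of length \<open>4 * C * r powr \<alpha>\<close>. These intervals cover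
  \<open>[0, 1)\<close>, which has measure one, and unlike the preimages they are certainly
  measurable.\<close>

lemma hausdorff_content_image_ge:
  fixes f :: "real \<Rightarrow> real"
  assumes \<alpha>: "0 < \<alpha>" "\<alpha> \<le> 1" and "C > 0"
    and f: "\<And>x x'. 0 \<le> x \<Longrightarrow> x < x' \<Longrightarrow> x' < 1 \<Longrightarrow> x' - x \<le> C * \<bar>f x' - f x\<bar> powr \<alpha>"
  shows "ennreal (1 / (4 * C)) \<le> hausdorff_content \<alpha> (f ` {0..<1})"
  unfolding hausdorff_content_def
proof (rule Inf_greatest)
  fix S assume "S \<in> {(\<Sum>j. ennreal (r j powr \<alpha>)) | (x :: nat \<Rightarrow> real) r.
      (\<forall>j. 0 \<le> r j) \<and> f ` {0..<1} \<subseteq> (\<Union>j. ball (x j) (r j))}"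
  then obtain c and r :: "nat \<Rightarrow> real" where S: "S = (\<Sum>j. ennreal (r j powr \<alpha>))"
    and r: "\<And>j. 0 \<le> r j" and cov: "f ` {0..<1} \<subseteq> (\<Union>j. ball (c j) (r j))"
    by blast
  define A where "A = (\<lambda>j. {x\<in>{0..<1}. f x \<in> ball (c j) (r j)})"
  \<comment> \<open>Some centre in the preimage; if that is empty, the value is arbitrary and the
    inclusion below trivial.\<close>
  define p where "p = (\<lambda>j. SOME x. x \<in> A j)"
  define \<rho> where "\<rho> = (\<lambda>j. 2 * C * r j powr \<alpha>)"
  have "A j \<subseteq> cball (p j) (\<rho> j)" for j
  proof
    fix x assume x: "x \<in> A j"
    then have p: "p j \<in> A j" unfolding p_def by (rule someI)
    have "\<bar>f x - f (p j)\<bar> \<le> 2 * r j" using x p by (auto simp: A_def dist_real_def)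
    then have "\<bar>f x - f (p j)\<bar> powr \<alpha> \<le> (2 * r j) powr \<alpha>" using \<alpha> by (intro powr_mono2) auto
    also have "\<dots> \<le> 2 * r j powr \<alpha>"
      using \<alpha> r[of j] powr_mono[of \<alpha> 1 2] by (auto simp: powr_mult intro!: mult_right_mono)
    finally have "C * \<bar>f x - f (p j)\<bar> powr \<alpha> \<le> \<rho> j" using \<open>C > 0\<close> by (simp add: \<rho>_def)
    moreover have "\<bar>x - p j\<bar> \<le> C * \<bar>f x - f (p j)\<bar> powr \<alpha>"
      using f[of x "p j"] f[of "p j" x] x p
      by (cases x "p j" rule: linorder_cases) (auto simp: A_def abs_minus_commute)
    ultimately show "x \<in> cball (p j) (\<rho> j)" by (simp add: dist_real_def abs_minus_commute)
  qed
  then have "(\<Union>j. A j) \<subseteq> (\<Union>j. cball (p j) (\<rho> j))" by (intro UN_mono subset_refl)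
  moreover have "{0..<1} \<subseteq> (\<Union>j. A j)"
  proof
    fix x :: real assume x: "x \<in> {0..<1}"
    then have "f x \<in> (\<Union>j. ball (c j) (r j))" by (intro subsetD[OF cov] imageI)
    then obtain j where "f x \<in> ball (c j) (r j)" by (rule UN_E)
    then have "x \<in> A j" using x by (simp add: A_def)
    then show "x \<in> (\<Union>j. A j)" by (rule UN_I[OF UNIV_I])
  qed
  ultimately have "{0..<1} \<subseteq> (\<Union>j. cball (p j) (\<rho> j))" by (rule order_trans[rotated])
  then have "emeasure lborel {0..<1::real} \<le> emeasure lborel (\<Union>j. cball (p j) (\<rho> j))"
    by (intro emeasure_mono) auto
  also have "\<dots> \<le> (\<Sum>j. emeasure lborel (cball (p j) (\<rho> j)))"
    by (intro emeasure_subadditive_countably) auto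
  also have "\<dots> = (\<Sum>j. ennreal (4 * C) * ennreal (r j powr \<alpha>))"
  proof (intro suminf_cong)
    fix j
    have "0 \<le> \<rho> j" using \<open>C > 0\<close> by (simp add: \<rho>_def)
    then have "emeasure lborel (cball (p j) (\<rho> j)) = ennreal (2 * \<rho> j)"
      by (simp add: cball_eq_atLeastAtMost)
    also have "2 * \<rho> j = (4 * C) * r j powr \<alpha>" by (simp add: \<rho>_def)
    also have "ennreal \<dots> = ennreal (4 * C) * ennreal (r j powr \<alpha>)"
      using \<open>C > 0\<close> by (intro ennreal_mult) auto
    finally show "emeasure lborel (cball (p j) (\<rho> j)) = ennreal (4 * C) * ennreal (r j powr \<alpha>)" .
  qed
  also have "\<dots> = ennreal (4 * C) * S" unfolding S by simp
  finally have "1 \<le> ennreal (4 * C) * S" by simp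
  then have "ennreal (1 / (4 * C)) * 1 \<le> ennreal (1 / (4 * C)) * (ennreal (4 * C) * S)"
    by (rule mult_left_mono) simp
  also have "\<dots> = ennreal (1 / (4 * C) * (4 * C)) * S"
    using \<open>C > 0\<close> by (subst ennreal_mult) (auto simp: mult.assoc)
  also have "\<dots> = S" using \<open>C > 0\<close> by simp
  finally show "ennreal (1 / (4 * C)) \<le> S" by simp
qed

text \<open>\<open>spread s J X\<close> moves the \<open>j\<close>-th of the \<open>J\<close> leading binary digits of \<open>X / 2 ^ J\<close> to position \<open>s j\<close>,
  and scales the result by \<open>2 ^ s J\<close>.\<close>
primrec spread :: "(nat \<Rightarrow> nat) \<Rightarrow> nat \<Rightarrow> nat \<Rightarrow> nat" where
  "spread s 0 X = 0"
| "spread s (Suc J) X = 2 ^ (s (Suc J) - s J) * spread s J (X div 2) + X mod 2"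

text \<open>If the digits before the last one differ, their images differ by at least one unit,
  which after the shift is at least 2 and outweighs the last digit. If they agree, the last digit
  decides.\<close>

lemma spread_strict_mono:
  assumes "strict_mono s" "X < X'" "X' < 2 ^ J"
  shows "spread s J X < spread s J X'"
  using assms(2,3)
proof (induction J arbitrary: X X')
  case (Suc J)
  have "s J < s (Suc J)" using assms(1) by (simp add: strict_mono_Suc_iff)
  then have two: "(2::nat) \<le> 2 ^ (s (Suc J) - s J)" by (intro self_le_power) auto
  show ?case
  proof (cases "X div 2 = X' div 2")
    case True
    then have "X mod 2 < X' mod 2" using Suc.prems by presburger
    then show ?thesis using True by simp
  next
    case False
    then have "X div 2 < X' div 2" "X' div 2 < 2 ^ J" using Suc.prems by auto
    then have "Suc (spread s J (X div 2)) \<le> spread s J (X' div 2)" using Suc.IH by (simp add: Suc_leI)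
    then have "2 ^ (s (Suc J) - s J) * Suc (spread s J (X div 2))
        \<le> 2 ^ (s (Suc J) - s J) * spread s J (X' div 2)" by (rule mult_le_mono2)
    then have le: "2 ^ (s (Suc J) - s J) + 2 ^ (s (Suc J) - s J) * spread s J (X div 2)
        \<le> 2 ^ (s (Suc J) - s J) * spread s J (X' div 2)" by simp
    have lin: "u + x < v + x'" if "p + u \<le> v" "x < 2" "2 \<le> p" for u v p x x' :: nat
      using that by linarith
    have "X mod 2 < 2" by simp
    then show ?thesis unfolding spread.simps by (rule lin[OF le _ two])
  qed
qed simp

text \<open>For \<open>x\<close> in \<open>[0, 1)\<close> the floor holds the first \<open>J\<close>
  binary digits; the division puts them behind the binary point again, at the positions
  \<open>s 1, ..., s J\<close>.\<close>

definition spread_trunc :: "(nat \<Rightarrow> nat) \<Rightarrow> nat \<Rightarrow> real \<Rightarrow> real" where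
  "spread_trunc s J x = real (spread s J (nat \<lfloor>2 ^ J * x\<rfloor>)) / 2 ^ s J"

definition spread_digits :: "(nat \<Rightarrow> nat) \<Rightarrow> real \<Rightarrow> real" where
  "spread_digits s x = (SUP J. spread_trunc s J x)"

text \<open>The first \<open>J\<close> digits arise from the first \<open>J + 1\<close> by
  \<open>div 2\<close>, so by the recursion of \<open>spread\<close> one more step adds a digit at
  position \<open>s (Suc J)\<close>. Hence the intervals of length \<open>1 / 2 ^ s J\<close> to the
  right of the truncations are nested.\<close>

lemma spread_trunc_Suc:
  assumes "strict_mono s" "0 \<le> x"
  shows "spread_trunc s J x \<le> spread_trunc s (Suc J) x"
    and "spread_trunc s (Suc J) x \<le> spread_trunc s J x + 1 / 2 ^ s (Suc J)"
    and "spread_trunc s (Suc J) x + 1 / 2 ^ s (Suc J) \<le> spread_trunc s J x + 1 / 2 ^ s J"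
proof -
  define X where "X = nat \<lfloor>2 ^ Suc J * x\<rfloor>"
  have "nat \<lfloor>2 ^ J * x\<rfloor> = X div 2"
  proof -
    have "\<lfloor>2 ^ J * x\<rfloor> = \<lfloor>(2 ^ Suc J * x) / of_int 2\<rfloor>" by simp
    also have "\<dots> = \<lfloor>2 ^ Suc J * x\<rfloor> div 2" by (rule floor_divide_real_eq_div) simp
    finally show ?thesis by (simp add: X_def nat_div_distrib)
  qed
  moreover have lt: "s J < s (Suc J)" using assms(1) by (simp add: strict_mono_Suc_iff)
  then have pow: "(2::real) ^ s (Suc J) = 2 ^ (s (Suc J) - s J) * 2 ^ s J" by (simp flip: power_add)
  ultimately have eq: "spread_trunc s (Suc J) x = spread_trunc s J x + real (X mod 2) / 2 ^ s (Suc J)"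
    unfolding spread_trunc_def X_def[symmetric] by (simp add: add_divide_distrib)
  show "spread_trunc s J x \<le> spread_trunc s (Suc J) x" unfolding eq by simp
  have "real (X mod 2) \<le> 1" by simp
  then have le: "real (X mod 2) / 2 ^ s (Suc J) \<le> 1 / 2 ^ s (Suc J)" by (intro divide_right_mono) auto
  then show "spread_trunc s (Suc J) x \<le> spread_trunc s J x + 1 / 2 ^ s (Suc J)" unfolding eq by simp
  have "(2::real) * 2 ^ s J \<le> 2 ^ s (Suc J)"
    using lt power_increasing[of "Suc (s J)" "s (Suc J)" "2::real"] by simp
  then have "2 / (2::real) ^ s (Suc J) \<le> 1 / 2 ^ s J" by (simp add: field_simps)
  then show "spread_trunc s (Suc J) x + 1 / 2 ^ s (Suc J) \<le> spread_trunc s J x + 1 / 2 ^ s J"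
    unfolding eq using le by simp
qed

text \<open>The limit lies in all the nested intervals. The third bound exploits the gap: the first
  digit after position \<open>s J\<close> sits at \<open>s (Suc J)\<close>.\<close>

lemma spread_digits_bounds:
  assumes "strict_mono s" "0 \<le> x"
  shows "spread_trunc s J x \<le> spread_digits s x"
    and "spread_digits s x \<le> spread_trunc s J x + 1 / 2 ^ s J"
    and "spread_digits s x \<le> spread_trunc s J x + 2 / 2 ^ s (Suc J)"
proof -
  have inc: "incseq (\<lambda>J. spread_trunc s J x)"
    by (intro incseq_SucI spread_trunc_Suc(1) assms)
  have dec: "decseq (\<lambda>J. spread_trunc s J x + 1 / 2 ^ s J)"
    by (intro decseq_SucI spread_trunc_Suc(3) assms)
  have le: "spread_trunc s i x \<le> spread_trunc s j x + 1 / 2 ^ s j" for i j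
  proof -
    have "spread_trunc s i x \<le> spread_trunc s (max i j) x" using incseqD[OF inc, of i "max i j"] by simp
    also have "\<dots> \<le> spread_trunc s (max i j) x + 1 / 2 ^ s (max i j)" by simp
    also have "\<dots> \<le> spread_trunc s j x + 1 / 2 ^ s j" using decseqD[OF dec, of j "max i j"] by simp
    finally show ?thesis .
  qed
  show "spread_trunc s J x \<le> spread_digits s x"
    unfolding spread_digits_def by (intro cSUP_upper bdd_aboveI2[OF le[of _ 0]]) auto
  have upper: "spread_digits s x \<le> spread_trunc s J x + 1 / 2 ^ s J" for J
    unfolding spread_digits_def by (intro cSUP_least le) auto
  then show "spread_digits s x \<le> spread_trunc s J x + 1 / 2 ^ s J" .
  show "spread_digits s x \<le> spread_trunc s J x + 2 / 2 ^ s (Suc J)"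
    using upper[of "Suc J"] spread_trunc_Suc(2)[OF assms, of J] add_divide_distrib[of 1 1 "2 ^ s (Suc J)"]
    by linarith
qed

text \<open>\<open>J\<close> is chosen with \<open>2 ^ J * (x' - x)\<close> between 2 and 4. The
  truncated integers then differ by at least 2, and so do their images. The tail of \<open>x\<close>
  uses up at most one unit, so a distance of at least \<open>1 / 2 ^ s J\<close> remains, whose
  power \<open>\<alpha>\<close> is at least \<open>1 / 2 ^ J\<close>.\<close>

lemma spread_digits_separated:
  assumes s: "strict_mono s" and \<alpha>: "0 < \<alpha>" and s\<alpha>: "\<And>j. \<alpha> * real (s j) \<le> real j"
    and x: "0 \<le> x" "x < x'" "x' < 1"
  shows "x' - x \<le> 4 * \<bar>spread_digits s x' - spread_digits s x\<bar> powr \<alpha>"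
proof -
  define d where "d = x' - x"
  have d: "0 < d" "d < 1" using x by (auto simp: d_def)
  obtain J0 where "(1/2) ^ J0 < d / 2" using real_arch_pow_inv[of "d/2" "1/2"] d by auto
  then have "2 / 2 ^ J0 \<le> d" by (simp add: power_divide field_simps)
  moreover have "\<not> 2 / 2 ^ 0 \<le> d" using d by simp
  ultimately obtain j where j: "\<not> 2 / 2 ^ j \<le> d" "2 / 2 ^ Suc j \<le> d"
    using ex_least_nat_less[of "\<lambda>J. 2 / 2 ^ J \<le> d" J0] by auto
  let ?J = "Suc j"
  let ?X = "nat \<lfloor>2 ^ ?J * x\<rfloor>" and ?X' = "nat \<lfloor>2 ^ ?J * x'\<rfloor>"
  have "2 ^ ?J * x + 2 \<le> 2 ^ ?J * x'" using j(2) by (simp add: d_def field_simps)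
  then have "\<lfloor>2 ^ ?J * x\<rfloor> + 2 \<le> \<lfloor>2 ^ ?J * x'\<rfloor>" by linarith
  moreover have "0 \<le> \<lfloor>2 ^ ?J * x\<rfloor>" using x by simp
  ultimately have X: "?X + 2 \<le> ?X'" by linarith
  have "2 ^ ?J * x' < 2 ^ ?J" using x by simp
  then have "\<lfloor>2 ^ ?J * x'\<rfloor> < 2 ^ ?J" by (simp add: floor_less_iff)
  then have X': "?X' < 2 ^ ?J" using x by (simp add: nat_less_iff)
  have "spread s ?J ?X < spread s ?J (Suc ?X)" "spread s ?J (Suc ?X) < spread s ?J ?X'"
    using X X' by (intro spread_strict_mono[OF s]; simp)+
  then have "real (spread s ?J ?X) + 2 \<le> real (spread s ?J ?X')" by linarith
  then have "(real (spread s ?J ?X) + 2) / 2 ^ s ?J \<le> real (spread s ?J ?X') / 2 ^ s ?J"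
    by (rule divide_right_mono) simp
  then have "spread_trunc s ?J x + 2 / 2 ^ s ?J \<le> spread_trunc s ?J x'"
    unfolding spread_trunc_def by (simp add: add_divide_distrib)
  moreover have "spread_digits s x \<le> spread_trunc s ?J x + 1 / 2 ^ s ?J"
    "spread_trunc s ?J x' \<le> spread_digits s x'"
    using x by (intro spread_digits_bounds[OF s]; simp)+
  ultimately have "1 / 2 ^ s ?J \<le> \<bar>spread_digits s x' - spread_digits s x\<bar>" by simp
  then have "(1 / 2 ^ s ?J) powr \<alpha> \<le> \<bar>spread_digits s x' - spread_digits s x\<bar> powr \<alpha>"
    using \<alpha> by (intro powr_mono2) auto
  moreover have "2 powr (- real ?J) \<le> (1 / 2 ^ s ?J) powr \<alpha>"
  proof -
    have "(1 / 2 ^ s ?J) powr \<alpha> = (2::real) powr (- (\<alpha> * real (s ?J)))"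
      by (simp add: powr_divide powr_minus_divide powr_powr mult.commute flip: powr_realpow)
    then show ?thesis using s\<alpha>[of ?J] by (simp only: powr_mono neg_le_iff_le)
  qed
  moreover have "d \<le> 4 * 2 powr (- real ?J)"
    using j(1) by (simp add: powr_minus powr_realpow field_simps flip: of_nat_Suc)
  ultimately show ?thesis unfolding d_def by linarith
qed

text \<open>Long gaps between the digit positions start right after the factorials; they are as long as the
  condition \<open>\<alpha> * s j \<le> j\<close> permits, and the earlier gaps do not matter since the factorials grow
  faster than geometrically.\<close>
lemma sparse_digit_positions:
  fixes \<alpha> :: real
  assumes \<alpha>: "0 < \<alpha>" "\<alpha> < 1"
  obtains s :: "nat \<Rightarrow> nat" where "strict_mono s" "s 0 = 0" "\<And>j. \<alpha> * real (s j) \<le> real j"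
    and "\<And>\<epsilon> R. \<epsilon> > 0 \<Longrightarrow> \<exists>j. real (s j) * (1/\<alpha> - \<epsilon>) - real (s (Suc j)) \<le> - R"
proof
  define \<beta> where "\<beta> = 1/\<alpha> - 1"
  have "\<beta> \<ge> 0" using \<alpha> by (simp add: \<beta>_def)
  \<comment> \<open>Inserting 0 keeps the set nonempty at \<open>j = 0\<close>: \<open>L j\<close>
    is the largest factorial up to \<open>j\<close>, or 0.\<close>
  define F where "F = (\<lambda>j. insert 0 {i::nat. i \<le> j \<and> (\<exists>k. i = fact k)})"
  define L where "L = (\<lambda>j. Max (F j))"
  have fin: "finite (F j)" "F j \<noteq> {}" for j by (auto simp: F_def)
  have Lle: "L j \<le> j" for j
    unfolding L_def using fin by (intro Max.boundedI) (auto simp: F_def)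
  have Lmono: "L i \<le> L j" if "i \<le> j" for i j
    unfolding L_def using that fin by (intro Max_mono) (auto simp: F_def)
  \<comment> \<open>At a factorial \<open>s j\<close> is the integer part of
    \<open>j / \<alpha>\<close>, the largest value allowed; between factorials it advances by
    one.\<close>
  define s where "s = (\<lambda>j. j + nat \<lfloor>\<beta> * real (L j)\<rfloor>)"
  have s_le: "real (s j) \<le> real j + \<beta> * real (L j)" for j
    using \<open>\<beta> \<ge> 0\<close> by (simp add: s_def)
  show "strict_mono s"
  proof (rule strict_monoI)
    fix i j :: nat assume "i < j"
    then have "\<beta> * real (L i) \<le> \<beta> * real (L j)" using Lmono[of i j] \<open>\<beta> \<ge> 0\<close> by (intro mult_left_mono) auto
    then have "nat \<lfloor>\<beta> * real (L i)\<rfloor> \<le> nat \<lfloor>\<beta> * real (L j)\<rfloor>" by (intro nat_mono floor_mono)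
    then show "s i < s j" using \<open>i < j\<close> by (simp add: s_def)
  qed
  show "s 0 = 0" using Lle[of 0] by (simp add: s_def)
  show "\<alpha> * real (s j) \<le> real j" for j
  proof -
    have "real (s j) \<le> real j + \<beta> * real j"
      using s_le[of j] Lle[of j] \<open>\<beta> \<ge> 0\<close> mult_left_mono[of "real (L j)" "real j" \<beta>] by simp
    also have "\<dots> = real j / \<alpha>" by (simp add: \<beta>_def algebra_simps)
    finally show ?thesis using \<alpha> by (simp add: field_simps)
  qed
  fix \<epsilon> R :: real assume "\<epsilon> > 0"
  \<comment> \<open>Makes \<open>\<epsilon> * k\<close> outweigh both
    \<open>\<beta>/\<alpha>\<close>, the effect of the earlier gaps, and the target
    \<open>R\<close>.\<close>
  obtain k :: nat where k: "(\<beta>/\<alpha> + \<bar>R\<bar> + \<epsilon> + 1) / \<epsilon> < real k" using reals_Archimedean2 by blast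
  define f where "f = (fact (Suc k) :: nat)"
  \<comment> \<open>The last index before a factorial: \<open>L j\<close> is at most the previous
    factorial \<open>f\<close>, while the long gap opens at
    \<open>Suc j = (k + 2) * f\<close>.\<close>
  define j where "j = fact (Suc (Suc k)) - (1::nat)"
  have f1: "f \<ge> 1" unfolding f_def by (rule fact_ge_1)
  have Sj: "Suc j = fact (Suc (Suc k))" unfolding j_def using fact_ge_1[of "Suc (Suc k)", where 'a = nat] by linarith
  have Sj': "real (Suc j) = real (Suc (Suc k)) * real f" unfolding Sj f_def by (simp add: algebra_simps)
  have "L j \<le> f"
    unfolding L_def
  proof (intro Max.boundedI fin)
    fix i assume "i \<in> F j"
    then consider "i = 0" | l where "i = fact l" "i \<le> j" by (auto simp: F_def)
    then show "i \<le> f"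
    proof cases
      case 2
      then have "(fact l :: nat) < fact (Suc (Suc k))" using Sj by linarith
      then have "l \<le> Suc k" using fact_mono_nat[of "Suc (Suc k)" l] by linarith
      then show ?thesis unfolding f_def 2(1) by (rule fact_mono_nat)
    qed simp
  qed
  moreover have "Suc j \<le> L (Suc j)"
    unfolding L_def using fin by (intro Max_ge) (auto simp: F_def Sj simp del: fact_Suc)
  ultimately have "real (s j) \<le> real j + \<beta> * real f"
    and "real (Suc j) + \<beta> * real (Suc j) - 1 \<le> real (s (Suc j))"
  proof -
    show "real (s j) \<le> real j + \<beta> * real f" if "L j \<le> f"
      using s_le[of j] that \<open>\<beta> \<ge> 0\<close> mult_left_mono[of "real (L j)" "real f" \<beta>] by simp
    show "real (Suc j) + \<beta> * real (Suc j) - 1 \<le> real (s (Suc j))" if "Suc j \<le> L (Suc j)"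
    proof -
      have "\<beta> * real (Suc j) \<le> \<beta> * real (L (Suc j))" using that \<open>\<beta> \<ge> 0\<close> by (intro mult_left_mono) auto
      then show ?thesis unfolding s_def by linarith
    qed
  qed
  note sj = this
  have "real (s j) * (1/\<alpha> - \<epsilon>) - real (s (Suc j))
      \<le> (real j + \<beta> * real f) / \<alpha> - \<epsilon> * real j - (real (Suc j) / \<alpha> - 1)"
  proof -
    have "real (s j) / \<alpha> \<le> (real j + \<beta> * real f) / \<alpha>" using sj(1) \<alpha> by (intro divide_right_mono) auto
    moreover have "\<epsilon> * real j \<le> \<epsilon> * real (s j)" using \<open>\<epsilon> > 0\<close> by (simp add: s_def)
    moreover have "real (Suc j) + \<beta> * real (Suc j) = real (Suc j) / \<alpha>"
      using \<alpha> by (simp add: \<beta>_def field_simps)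
    ultimately show ?thesis using sj(2) by (simp only: right_diff_distrib) (simp add: mult.commute)
  qed
  also have "\<dots> \<le> real f * (\<beta>/\<alpha>) - \<epsilon> * real (Suc j) + \<epsilon> + 1"
  proof -
    have "real (Suc j) / \<alpha> = real j / \<alpha> + 1 / \<alpha>" using \<alpha> by (simp add: field_simps)
    moreover have "(real j + \<beta> * real f) / \<alpha> = real j / \<alpha> + real f * (\<beta>/\<alpha>)"
      using \<alpha> by (simp add: field_simps)
    moreover have "1 / \<alpha> > 0" using \<alpha> by simp
    moreover have "\<epsilon> * real (Suc j) = \<epsilon> * real j + \<epsilon>" by (simp add: algebra_simps)
    ultimately show ?thesis by linarith
  qed
  also have "\<dots> = real f * (\<beta>/\<alpha> - \<epsilon> * real (Suc (Suc k))) + (\<epsilon> + 1)"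
    unfolding Sj' by (simp add: algebra_simps)
  also have "\<dots> \<le> real f * (- (\<bar>R\<bar> + \<epsilon> + 1)) + (\<epsilon> + 1)"
  proof (intro add_right_mono mult_left_mono)
    have "\<beta>/\<alpha> + \<bar>R\<bar> + \<epsilon> + 1 < \<epsilon> * real k" using k \<open>\<epsilon> > 0\<close> by (simp add: field_simps)
    also have "\<dots> \<le> \<epsilon> * real (Suc (Suc k))" using \<open>\<epsilon> > 0\<close> by (intro mult_left_mono) auto
    finally show "\<beta>/\<alpha> - \<epsilon> * real (Suc (Suc k)) \<le> - (\<bar>R\<bar> + \<epsilon> + 1)" by simp
  qed simp
  also have "\<dots> \<le> 1 * (- (\<bar>R\<bar> + \<epsilon> + 1)) + (\<epsilon> + 1)"
    using f1 \<open>\<epsilon> > 0\<close> by (intro add_right_mono mult_right_mono_neg) auto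
  also have "\<dots> \<le> - R" by simp
  finally show "\<exists>j. real (s j) * (1/\<alpha> - \<epsilon>) - real (s (Suc j)) \<le> - R" by blast
qed

section \<open>A two-term polynomial that is small on the set of spread digits\<close>

lemma cmod_one_minus_cis_le: "cmod (1 - cis a) \<le> \<bar>a\<bar>"
proof -
  have "(cmod (1 - cis a))\<^sup>2 = 2 - 2 * cos a"
    using sin_cos_squared_add[of a] by (simp add: cmod_power2) (simp add: power2_eq_square algebra_simps)
  also have "\<dots> = (2 * sin (a/2))\<^sup>2"
    using cos_double_sin[of "a/2"] by (simp add: power_mult_distrib)
  finally have "cmod (1 - cis a) = \<bar>2 * sin (a/2)\<bar>"
    using power2_eq_iff_nonneg[of "cmod (1 - cis a)" "\<bar>2 * sin (a/2)\<bar>"] by simp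
  also have "\<dots> \<le> \<bar>a\<bar>" using abs_sin_x_le_abs_x[of "a/2"] by (simp add: abs_mult)
  finally show ?thesis .
qed

text \<open>One set defeats every \<open>C\<close>. On it \<open>2 ^ s j * t\<close> is within
  \<open>2 * 2 ^ s j / 2 ^ s (Suc j)\<close> of an integer, so
  \<open>1 - cis (2 * pi * 2 ^ s j * t)\<close> is small although its maximum is 2. Before a long
  gap this beats the power \<open>1/\<alpha> - 1 - \<epsilon>\<close> of
  \<open>2 ^ s j\<close>.\<close>

lemma Sup_norm_trig_poly_not_bounded:
  fixes \<alpha> \<epsilon> :: real
  assumes \<alpha>: "0 < \<alpha>" "\<alpha> < 1" and "\<epsilon> > 0"
  obtains E where "E \<subseteq> {0..1}" "hausdorff_content \<alpha> E > 0"
    and "\<And>C. \<exists>c m. strict_mono_on {1..2} m \<and>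
           C * real_of_int (m 2 - m 1) powr (1/\<alpha> - 1 - \<epsilon>) * (SUP t\<in>E. cmod (trig_poly 2 c m t))
             < (SUP t\<in>{0..1}. cmod (trig_poly 2 c m t))"
proof (rule sparse_digit_positions[OF \<alpha>])
  fix s :: "nat \<Rightarrow> nat"
  assume s: "strict_mono s" "s 0 = 0" "\<And>j. \<alpha> * real (s j) \<le> real j"
    and gaps: "\<And>\<epsilon> R. \<epsilon> > 0 \<Longrightarrow> \<exists>j. real (s j) * (1/\<alpha> - \<epsilon>) - real (s (Suc j)) \<le> - R"
  define E where "E = spread_digits s ` {0..<1}"
  have "ennreal (1 / (4 * 4)) \<le> hausdorff_content \<alpha> E"
    unfolding E_def using \<alpha> s by (intro hausdorff_content_image_ge spread_digits_separated) auto
  then have content: "hausdorff_content \<alpha> E > 0" by (rule less_le_trans[rotated]) simp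
  have E01: "E \<subseteq> {0..1}"
  proof
    fix t assume "t \<in> E"
    then obtain x where x: "t = spread_digits s x" "0 \<le> x" by (auto simp: E_def)
    then show "t \<in> {0..1}"
      using spread_digits_bounds(1,2)[OF s(1) x(2), of 0] s(2) by (simp add: spread_trunc_def)
  qed
  have "\<exists>c m. strict_mono_on {1..2} m \<and>
           C * real_of_int (m 2 - m 1) powr (1/\<alpha> - 1 - \<epsilon>) * (SUP t\<in>E. cmod (trig_poly 2 c m t))
             < (SUP t\<in>{0..1}. cmod (trig_poly 2 c m t))" for C
  proof -
    define K where "K = \<bar>C\<bar> * (4 * pi)"
    have "K \<ge> 0" by (simp add: K_def)
    \<comment> \<open>With this target the final bound becomes \<open>K / (K + 1)\<close>, below the
      maximum 2.\<close>
    obtain j where j: "real (s j) * (1/\<alpha> - \<epsilon>) - real (s (Suc j)) \<le> - log 2 (K + 1)"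
      using gaps[OF \<open>\<epsilon> > 0\<close>] by blast
    define c :: "nat \<Rightarrow> complex" where "c = (\<lambda>k. if k = 1 then 1 else - 1)"
    define m :: "nat \<Rightarrow> int" where "m = (\<lambda>k. if k = 1 then 0 else 2 ^ s j)"
    have p: "trig_poly 2 c m t = 1 - cis (2 * pi * 2 ^ s j * t)" for t
      by (simp add: trig_poly_cis numeral_2_eq_2 c_def m_def)
    have m12: "real_of_int (m 2 - m 1) = 2 powr real (s j)"
      by (simp add: m_def powr_realpow)
    have small: "cmod (trig_poly 2 c m t) \<le> 4 * pi * 2 powr (real (s j) - real (s (Suc j)))" if "t \<in> E" for t
    proof -
      obtain x where x: "t = spread_digits s x" "0 \<le> x" using \<open>t \<in> E\<close> by (auto simp: E_def)
      \<comment> \<open>The digits of \<open>t\<close> after position \<open>s j\<close>; the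
        earlier ones contribute an integer to \<open>2 ^ s j * t\<close> and disappear under
        \<open>cis\<close>.\<close>
      define \<theta> where "\<theta> = t - spread_trunc s j x"
      have \<theta>: "0 \<le> \<theta>" "\<theta> \<le> 2 / 2 ^ s (Suc j)"
        using spread_digits_bounds(1,3)[OF s(1) x(2), of j] by (auto simp: \<theta>_def x(1))
      have "2 ^ s j * t = real (spread s j (nat \<lfloor>2 ^ j * x\<rfloor>)) + 2 ^ s j * \<theta>"
        by (simp add: \<theta>_def spread_trunc_def field_simps)
      then have "cis (2 * pi * 2 ^ s j * t)
          = cis (2 * pi * real (spread s j (nat \<lfloor>2 ^ j * x\<rfloor>))) * cis (2 * pi * 2 ^ s j * \<theta>)"
        by (simp only: cis_mult mult.assoc distrib_left)
      also have "\<dots> = cis (2 * pi * 2 ^ s j * \<theta>)" by (simp add: cis_multiple_2pi)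
      finally have "cmod (trig_poly 2 c m t) \<le> 2 * pi * 2 ^ s j * \<theta>"
        using cmod_one_minus_cis_le[of "2 * pi * 2 ^ s j * \<theta>"] \<theta> by (simp add: p)
      also have "\<dots> \<le> 2 * pi * 2 ^ s j * (2 / 2 ^ s (Suc j))" using \<theta> by (intro mult_left_mono) auto
      also have "\<dots> = 4 * pi * 2 powr (real (s j) - real (s (Suc j)))"
        by (simp add: powr_diff powr_realpow)
      finally show ?thesis .
    qed
    have "0 \<in> {0..<1::real}" by simp
    then have "E \<noteq> {}" by (auto simp: E_def)
    then have SupE: "(SUP t\<in>E. cmod (trig_poly 2 c m t)) \<le> 4 * pi * 2 powr (real (s j) - real (s (Suc j)))"
      by (intro cSUP_least small)
    obtain t0 where "t0 \<in> E" using \<open>E \<noteq> {}\<close> by blast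
    then have SupE0: "0 \<le> (SUP t\<in>E. cmod (trig_poly 2 c m t))"
      using cSUP_upper[OF _ bdd_above_norm_trig_poly] norm_ge_zero order_trans by blast
    have "C * real_of_int (m 2 - m 1) powr (1/\<alpha> - 1 - \<epsilon>) * (SUP t\<in>E. cmod (trig_poly 2 c m t))
        \<le> \<bar>C\<bar> * real_of_int (m 2 - m 1) powr (1/\<alpha> - 1 - \<epsilon>) * (SUP t\<in>E. cmod (trig_poly 2 c m t))"
      using SupE0 by (intro mult_right_mono) auto
    also have "\<dots> \<le> \<bar>C\<bar> * real_of_int (m 2 - m 1) powr (1/\<alpha> - 1 - \<epsilon>)
        * (4 * pi * 2 powr (real (s j) - real (s (Suc j))))"
      using SupE by (intro mult_left_mono) auto
    also have "\<dots> = K * (2 powr (real (s j) * (1/\<alpha> - 1 - \<epsilon>)) * 2 powr (real (s j) - real (s (Suc j))))"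
      unfolding m12 by (simp add: K_def powr_powr)
    also have "\<dots> = K * 2 powr (real (s j) * (1/\<alpha> - \<epsilon>) - real (s (Suc j)))"
      by (simp add: algebra_simps flip: powr_add)
    also have "\<dots> \<le> K * 2 powr (- log 2 (K + 1))"
      using j \<open>K \<ge> 0\<close> by (intro mult_left_mono powr_mono) auto
    also have "\<dots> = K / (K + 1)"
      using \<open>K \<ge> 0\<close> by (simp add: powr_minus_divide)
    also have "\<dots> < 2" using \<open>K \<ge> 0\<close> by (simp add: field_simps)
    \<comment> \<open>Half a period: the exponential equals -1 there.\<close>
    also have "2 = cmod (trig_poly 2 c m (1 / 2 ^ Suc (s j)))"
      by (simp add: p)
    also have "\<dots> \<le> (SUP t\<in>{0..1}. cmod (trig_poly 2 c m t))"
      using one_le_power[of "2::real" "Suc (s j)"]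
      by (intro cSUP_upper bdd_above_norm_trig_poly) (simp del: power_Suc)
    finally have "C * real_of_int (m 2 - m 1) powr (1/\<alpha> - 1 - \<epsilon>) * (SUP t\<in>E. cmod (trig_poly 2 c m t))
        < (SUP t\<in>{0..1}. cmod (trig_poly 2 c m t))" .
    moreover have "strict_mono_on {1..2} m" by (auto simp: strict_mono_on_def m_def)
    ultimately show ?thesis by blast
  qed
  then show ?thesis using that E01 content by blast
qed

theorem theorem1p2:
  "(\<forall>\<alpha>::real. 0 < \<alpha> \<and> \<alpha> < 1 \<longrightarrow>
      \<not> (\<forall>E \<subseteq> {0..1}. hausdorff_content \<alpha> E > 0 \<longrightarrow>
           (\<forall>n\<ge>1. \<exists>C::real. \<forall>p \<in> trig_polys n.
              (SUP t\<in>{0..1}. cmod (p t)) \<le> C * (SUP t\<in>E. cmod (p t)))))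
   \<and>
   (\<exists>C\<^sub>0::real. C\<^sub>0 > 0 \<and>
      (\<forall>\<alpha>::real. 0 < \<alpha> \<and> \<alpha> < 1 \<longrightarrow>
         (\<forall>E \<subseteq> {0..1}. hausdorff_content \<alpha> E > 0 \<longrightarrow>
            (\<forall>n\<ge>1. \<forall>c m. strict_mono_on {1..n} m \<longrightarrow>
               (SUP t\<in>{0..1}. cmod (trig_poly n c m t))
                 \<le> ((C\<^sub>0 * (real n - 1) / enn2real (hausdorff_content \<alpha> E)) powr (1 / \<alpha>)
                      * real_of_int (m n - m 1) powr (1 / \<alpha> - 1)) ^ (n - 1)
                    * (SUP t\<in>E. cmod (trig_poly n c m t))))))
   \<and>
   (\<forall>\<alpha>::real. 0 < \<alpha> \<and> \<alpha> < 1 \<longrightarrow>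
      (\<forall>\<epsilon>::real. \<epsilon> > 0 \<longrightarrow>
         \<not> (\<forall>E \<subseteq> {0..1}. hausdorff_content \<alpha> E > 0 \<longrightarrow>
              (\<forall>n\<ge>1. \<exists>C\<^sub>1::real. \<forall>c m. strict_mono_on {1..n} m \<longrightarrow>
                 (SUP t\<in>{0..1}. cmod (trig_poly n c m t))
                   \<le> C\<^sub>1 * (real_of_int (m n - m 1) powr (1 / \<alpha> - 1 - \<epsilon>)) ^ (n - 1)
                        * (SUP t\<in>E. cmod (trig_poly n c m t))))))"
proof (intro conjI)
  show "\<forall>\<alpha>::real. 0 < \<alpha> \<and> \<alpha> < 1 \<longrightarrow>
      \<not> (\<forall>E \<subseteq> {0..1}. hausdorff_content \<alpha> E > 0 \<longrightarrow>
           (\<forall>n\<ge>1. \<exists>C::real. \<forall>p \<in> trig_polys n.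
              (SUP t\<in>{0..1}. cmod (p t)) \<le> C * (SUP t\<in>E. cmod (p t))))"
  proof (intro allI impI notI)
    fix \<alpha> :: real assume \<alpha>: "0 < \<alpha> \<and> \<alpha> < 1"
    assume bounded: "\<forall>E \<subseteq> {0..1}. hausdorff_content \<alpha> E > 0 \<longrightarrow>
           (\<forall>n\<ge>1. \<exists>C::real. \<forall>p \<in> trig_polys n.
              (SUP t\<in>{0..1}. cmod (p t)) \<le> C * (SUP t\<in>E. cmod (p t)))"
    \<comment> \<open>With \<open>\<epsilon>\<close> equal to \<open>1/\<alpha> - 1\<close> the
      exponent of \<open>m 2 - m 1\<close> vanishes, so the same set also excludes a bound by a
      constant alone.\<close>
    have "1/\<alpha> - 1 > 0" using \<alpha> by simp
    then show False
    proof (rule Sup_norm_trig_poly_not_bounded[OF conjunct1[OF \<alpha>] conjunct2[OF \<alpha>]])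
      fix E assume E: "E \<subseteq> {0..1}" "hausdorff_content \<alpha> E > 0"
        and large: "\<And>C. \<exists>c m. strict_mono_on {1..2} m \<and>
           C * real_of_int (m 2 - m 1) powr (1/\<alpha> - 1 - (1/\<alpha> - 1)) * (SUP t\<in>E. cmod (trig_poly 2 c m t))
             < (SUP t\<in>{0..1}. cmod (trig_poly 2 c m t))"
      have "\<exists>C::real. \<forall>p \<in> trig_polys 2. (SUP t\<in>{0..1}. cmod (p t)) \<le> C * (SUP t\<in>E. cmod (p t))"
        using bounded[rule_format, OF E, of 2] by simp
      then obtain C where C: "\<And>p. p \<in> trig_polys 2 \<Longrightarrow>
          (SUP t\<in>{0..1}. cmod (p t)) \<le> C * (SUP t\<in>E. cmod (p t))"
        by blast
      obtain c m where m: "strict_mono_on {1..2} m"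
        and cm: "C * real_of_int (m 2 - m 1) powr (1/\<alpha> - 1 - (1/\<alpha> - 1)) * (SUP t\<in>E. cmod (trig_poly 2 c m t))
             < (SUP t\<in>{0..1}. cmod (trig_poly 2 c m t))"
        using large by blast
      have "trig_poly 2 c m \<in> trig_polys 2" using m by (auto simp: trig_polys_def)
      \<comment> \<open>\<open>powr\<close> with exponent 0 gives 1 only for a nonzero base.\<close>
      moreover have "m 1 < m 2" using strict_mono_onD[OF m, of 1 2] by simp
      ultimately show False using C[of "trig_poly 2 c m"] cm by simp
    qed
  qed
next
  show "\<exists>C\<^sub>0::real. C\<^sub>0 > 0 \<and>
      (\<forall>\<alpha>::real. 0 < \<alpha> \<and> \<alpha> < 1 \<longrightarrow>
         (\<forall>E \<subseteq> {0..1}. hausdorff_content \<alpha> E > 0 \<longrightarrow>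
            (\<forall>n\<ge>1. \<forall>c m. strict_mono_on {1..n} m \<longrightarrow>
               (SUP t\<in>{0..1}. cmod (trig_poly n c m t))
                 \<le> ((C\<^sub>0 * (real n - 1) / enn2real (hausdorff_content \<alpha> E)) powr (1 / \<alpha>)
                      * real_of_int (m n - m 1) powr (1 / \<alpha> - 1)) ^ (n - 1)
                    * (SUP t\<in>E. cmod (trig_poly n c m t)))))"
    using Sup_norm_trig_poly_le by (intro exI[of _ 16]) simp
next
  show "\<forall>\<alpha>::real. 0 < \<alpha> \<and> \<alpha> < 1 \<longrightarrow>
      (\<forall>\<epsilon>::real. \<epsilon> > 0 \<longrightarrow>
         \<not> (\<forall>E \<subseteq> {0..1}. hausdorff_content \<alpha> E > 0 \<longrightarrow>
              (\<forall>n\<ge>1. \<exists>C\<^sub>1::real. \<forall>c m. strict_mono_on {1..n} m \<longrightarrow>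
                 (SUP t\<in>{0..1}. cmod (trig_poly n c m t))
                   \<le> C\<^sub>1 * (real_of_int (m n - m 1) powr (1 / \<alpha> - 1 - \<epsilon>)) ^ (n - 1)
                        * (SUP t\<in>E. cmod (trig_poly n c m t)))))"
  proof (intro allI impI notI)
    fix \<alpha> \<epsilon> :: real assume \<alpha>: "0 < \<alpha> \<and> \<alpha> < 1" and \<epsilon>: "\<epsilon> > 0"
    assume bounded: "\<forall>E \<subseteq> {0..1}. hausdorff_content \<alpha> E > 0 \<longrightarrow>
              (\<forall>n\<ge>1. \<exists>C\<^sub>1::real. \<forall>c m. strict_mono_on {1..n} m \<longrightarrow>
                 (SUP t\<in>{0..1}. cmod (trig_poly n c m t))
                   \<le> C\<^sub>1 * (real_of_int (m n - m 1) powr (1 / \<alpha> - 1 - \<epsilon>)) ^ (n - 1)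
                        * (SUP t\<in>E. cmod (trig_poly n c m t)))"
    show False
    proof (rule Sup_norm_trig_poly_not_bounded[OF conjunct1[OF \<alpha>] conjunct2[OF \<alpha>] \<epsilon>])
      fix E assume E: "E \<subseteq> {0..1}" "hausdorff_content \<alpha> E > 0"
        and large: "\<And>C. \<exists>c m. strict_mono_on {1..2} m \<and>
           C * real_of_int (m 2 - m 1) powr (1/\<alpha> - 1 - \<epsilon>) * (SUP t\<in>E. cmod (trig_poly 2 c m t))
             < (SUP t\<in>{0..1}. cmod (trig_poly 2 c m t))"
      obtain C where C: "\<And>c m. strict_mono_on {1..2} m \<Longrightarrow>
          (SUP t\<in>{0..1}. cmod (trig_poly 2 c m t))
            \<le> C * (real_of_int (m 2 - m 1) powr (1 / \<alpha> - 1 - \<epsilon>)) ^ (2 - 1)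
                 * (SUP t\<in>E. cmod (trig_poly 2 c m t))"
        using bounded[rule_format, OF E, of 2] by (metis one_le_numeral)
      obtain c m where m: "strict_mono_on {1..2} m"
        and cm: "C * real_of_int (m 2 - m 1) powr (1/\<alpha> - 1 - \<epsilon>) * (SUP t\<in>E. cmod (trig_poly 2 c m t))
             < (SUP t\<in>{0..1}. cmod (trig_poly 2 c m t))"
        using large by blast
      show False using C[OF m, of c] cm by simp
    qed
  qed
qed

end
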